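(* Let $(\mathcal U\to\mathcal X\to(B,b_0))$ be a splitting type deformation. Suppose $(\mathcal U\to\mathcal X)$ is of splitting type $j'$ and weakly non-split. Then the classifying map $\Psi_{(\mathcal U\to\mathcal X)}$ cannot be a map of pointed sets.
   Context: A model $(Y,T^*_{Y,-})$ is a complex manifold $Y$ with a holomorphic vector bundle $T^*_{Y,-}$. For $j\ge2$, $\mathcal G^{(j)}_{T^*_{Y,-}}$ is the sheaf of groups of parity-preserving $\mathbb C$-algebra automorphisms $\alpha$ of $\wedge^\bullet T^*_{Y,-}$ with $\alpha(u)-u\in\bigoplus_{k\ge j}\wedge^kT^*_{Y,-}$ for all local sections $u$. A supermanifold $(\mathcal U\to\mathcal X)$ modelled on $(Y,T^*_{Y,-})$ with splitting type $j$ is a representative of a class in the pointed set $\check H^1(Y,\mathcal G^{(j)}_{T^*_{Y,-}})$; for $j>\mathrm{rank}\,T^*_{Y,-}$ the sheaf is trivial, one writes $j=\infty$, and the supermanifold is the split model $S(Y,T^*_{Y,-})$. Standing assumption: a supermanifold of splitting type $j$ does not have splitting type $j+1$ unless $j=\infty$. For $j>k$, inclusion of sheaves induces $\check H^1(Y,\mathcal G^{(j)}_{T^*_{Y,-}})\to\check H^1(Y,\mathcal G^{(k)}_{T^*_{Y,-}})$. A supermanifold of splitting type $j$ is weakly non-split if (i) its class in $\check H^1(Y,\mathcal G^{(j)}_{T^*_{Y,-}})$ is not the base-point and (ii) for every $k$ with $2\le k<j$ the image of its class in $\check H^1(Y,\mathcal G^{(k)}_{T^*_{Y,-}})$ is not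 the base-point. An embedding of models $(X,T^*_{X,-})\subset(Y,T^*_{Y,-})$ is an inclusion $i:X\subset Y$ of a submanifold with a surjection $i^*T^*_{Y,-}\to T^*_{X,-}$. Let $\mathcal G^{(j)}_{T^*_{X,-};T^*_{Y,-}}\subset\mathcal G^{(j)}_{T^*_{Y,-}}$ be the automorphisms restricting to automorphisms in $\mathcal G^{(j)}_{T^*_{X,-}}$, with induced maps of pointed sets $u_*:\check H^1(Y,\mathcal G^{(j)}_{T^*_{X,-};T^*_{Y,-}})\to\check H^1(Y,\mathcal G^{(j)}_{T^*_{Y,-}})$ and $r_*:\check H^1(Y,\mathcal G^{(j)}_{T^*_{X,-};T^*_{Y,-}})\to\check H^1(X,\mathcal G^{(j)}_{T^*_{X,-}})$; the base-point of the source is represented by the embedding of split models $S(X,T^*_{X,-})\subset S(Y,T^*_{Y,-})$. An embedding of splitting type $(j'',j,j')$, $j''\le j,j'$, of a supermanifold of splitting type $j$ modelled on $(X,T^*_{X,-})$ in one of splitting type $j'$ modelled on $(Y,T^*_{Y,-})$ is a class $c\in\check H^1(Y,\mathcal G^{(j'')}_{T^*_{X,-};T^*_{Y,-}})$ such that $r_*(c)$ and $u_*(c)$ are the images of the classes of the two supermanifolds in level $j''$. A family of supermanifolds $(\mathcal U\to\mathcal X\to B)$ modelled on $(X,T^*_{X,-})$ is a supermanifold $(\mathcal U\to\mathcal X)$ (the total space, modelled on some $(Y,T^*_{Y,-})$) with a morphism $f:\mathcal X\to B$ whose reduced part $Y\to B$ is an analytic family of compact complex manifolds (surjective holomorphic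 submersion with compact fibers), and for each $b\in B$ a supermanifold $(\mathcal U_b\to\mathcal X_b)$ modelled on $(X,T^*_{X,-})$ of splitting type $j_b$ together with an embedding $(\mathcal U_b\to\mathcal X_b)\subset(\mathcal U\to\mathcal X)$, of some splitting type $(j''_b,j_b,j')$, with class $c_b\in\check H^1(Y,\mathcal G^{(j''_b)}_{T^*_{X,-};T^*_{Y,-}})$. A splitting type deformation $(\mathcal U\to\mathcal X\to(B,b_0))$ (of the fiber over $b_0$) is such a family with a distinguished base-point $b_0\in B$. The classifying map $\Psi_{(\mathcal U\to\mathcal X)}$ is $b\mapsto c_b$. It is a map of pointed sets if $c_{b_0}$ is the base-point of $\check H^1(Y,\mathcal G^{(j''_{b_0})}_{T^*_{X,-};T^*_{Y,-}})$. *)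

theory Defs
  imports "HOL-Analysis.Analysis" "HOL-Algebra.Module" "HOL-Algebra.QuotRing"
    "HOL-Library.Extended_Nat"
begin

section \<open>Holomorphic functions of several variables and complex manifolds\<close>

text \<open>
  The space of \<open>n\<close>-tuples of complex numbers is the set of sequences that vanish from index \<open>n\<close>
  on, with the subspace topology of the product topology.  This allows every dimension, including
  \<open>0\<close>, to be a natural number, and makes the space of dimension \<open>m \<le> n\<close> a subset of the one of
  dimension \<open>n\<close>.
\<close>

definition cspace :: "nat \<Rightarrow> (nat \<Rightarrow> complex) set" where
  "cspace n = {z. \<forall>i\<ge>n. z i = 0}"

text \<open>\<open>f\<close> is complex (Frechet) differentiable at \<open>z\<close> with partial derivatives \<open>a\<close>.\<close>

definition has_cgradient ::
  "nat \<Rightarrow> ((nat \<Rightarrow> complex) \<Rightarrow> complex) \<Rightarrow> (nat \<Rightarrow> complex) \<Rightarrow> (nat \<Rightarrow> complex) \<Rightarrow> bool" where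
  "has_cgradient n f a z \<longleftrightarrow>
     ((\<lambda>w. (f w - f z - (\<Sum>i<n. a i * (w i - z i))) / of_real (\<Sum>i<n. cmod (w i - z i)))
        \<longlongrightarrow> 0) (at z within cspace n)"

definition holomorphic_n :: "nat \<Rightarrow> (nat \<Rightarrow> complex) set \<Rightarrow> ((nat \<Rightarrow> complex) \<Rightarrow> complex) \<Rightarrow> bool" where
  "holomorphic_n n D f \<longleftrightarrow> (\<forall>z\<in>D. \<exists>a. has_cgradient n f a z)"

type_synonym 'a chart = "'a set \<times> ('a \<Rightarrow> nat \<Rightarrow> complex)"

record 'a cmanifold =
  mtop :: "'a topology"
  mdim :: nat
  atlas :: "'a chart set"

abbreviation points :: "('a, 'b) cmanifold_scheme \<Rightarrow> 'a set" where
  "points M \<equiv> topspace (mtop M)"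

definition top_chart :: "('a, 'b) cmanifold_scheme \<Rightarrow> 'a chart \<Rightarrow> bool" where
  "top_chart M = (\<lambda>(U, \<phi>). openin (mtop M) U \<and>
     openin (top_of_set (cspace (mdim M))) (\<phi> ` U) \<and>
     homeomorphic_map (subtopology (mtop M) U) (top_of_set (\<phi> ` U)) \<phi>)"

definition hol_transition :: "nat \<Rightarrow> 'a chart \<Rightarrow> 'a chart \<Rightarrow> bool" where
  "hol_transition n = (\<lambda>(U, \<phi>) (V, \<psi>).
     \<forall>i<n. holomorphic_n n (\<phi> ` (U \<inter> V)) (\<lambda>z. \<psi> (inv_into U \<phi> z) i))"

definition complex_manifold :: "('a, 'b) cmanifold_scheme \<Rightarrow> bool" where
  "complex_manifold M \<longleftrightarrow>
     Hausdorff_space (mtop M) \<and> second_countable (mtop M) \<and>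
     (\<forall>c\<in>atlas M. top_chart M c) \<and> (\<Union>(U, \<phi>)\<in>atlas M. U) = points M \<and>
     (\<forall>c\<in>atlas M. \<forall>d\<in>atlas M. hol_transition (mdim M) c d)"

definition max_atlas :: "('a, 'b) cmanifold_scheme \<Rightarrow> 'a chart set" where
  "max_atlas M = {c. top_chart M c \<and>
     (\<forall>d\<in>atlas M. hol_transition (mdim M) c d \<and> hol_transition (mdim M) d c)}"

definition hol_fun :: "('a, 'b) cmanifold_scheme \<Rightarrow> 'a set \<Rightarrow> ('a \<Rightarrow> complex) \<Rightarrow> bool" where
  "hol_fun M U f \<longleftrightarrow>
     (\<forall>(V, \<phi>)\<in>atlas M. holomorphic_n (mdim M) (\<phi> ` (U \<inter> V)) (\<lambda>z. f (inv_into V \<phi> z)))"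

abbreviation preim :: "('a, 'b) cmanifold_scheme \<Rightarrow> ('a \<Rightarrow> 'c) \<Rightarrow> 'c set \<Rightarrow> 'a set" where
  "preim X i V \<equiv> {x \<in> points X. i x \<in> V}"

text \<open>
  \<open>i\<close> identifies \<open>X\<close> with a submanifold of \<open>Y\<close>: around every point of the image there is a chart of
  \<open>Y\<close> that flattens the image and whose restriction is a chart of \<open>X\<close>.
\<close>

definition submanifold_inclusion ::
  "('x, 'c) cmanifold_scheme \<Rightarrow> ('y, 'd) cmanifold_scheme \<Rightarrow> ('x \<Rightarrow> 'y) \<Rightarrow> bool" where
  "submanifold_inclusion X Y i \<longleftrightarrow> i ` points X \<subseteq> points Y \<and>
     (\<forall>x\<in>points X. \<exists>(U, \<phi>)\<in>max_atlas Y. i x \<in> U \<and>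
        \<phi> ` (U \<inter> i ` points X) = \<phi> ` U \<inter> cspace (mdim X) \<and>
        (preim X i U, \<phi> \<circ> i) \<in> max_atlas X)"

text \<open>
  Holomorphic with surjective differential everywhere; \<open>J\<close> is the Jacobian matrix in the two charts.
\<close>

definition holomorphic_submersion ::
  "('y, 'c) cmanifold_scheme \<Rightarrow> ('b, 'd) cmanifold_scheme \<Rightarrow> ('y \<Rightarrow> 'b) \<Rightarrow> bool" where
  "holomorphic_submersion Y B p \<longleftrightarrow> continuous_map (mtop Y) (mtop B) p \<and>
     (\<forall>y\<in>points Y. \<forall>(U, \<phi>)\<in>atlas Y. \<forall>(W, \<psi>)\<in>atlas B. y \<in> U \<and> p y \<in> W \<longrightarrow>
        (\<exists>J. (\<forall>r<mdim B.
                has_cgradient (mdim Y) (\<lambda>z. \<psi> (p (inv_into U \<phi> z)) r) (J r) (\<phi> y)) \<and>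
             (\<forall>w. \<exists>v. \<forall>r<mdim B. (\<Sum>k<mdim Y. J r k * v k) = w r)))"

definition analytic_family ::
  "('y, 'c) cmanifold_scheme \<Rightarrow> ('b, 'd) cmanifold_scheme \<Rightarrow> ('y \<Rightarrow> 'b) \<Rightarrow> bool" where
  "analytic_family Y B p \<longleftrightarrow> holomorphic_submersion Y B p \<and> p ` points Y = points B \<and>
     (\<forall>b\<in>points B. compactin (mtop Y) (preim Y p {b}))"


section \<open>Holomorphic vector bundles\<close>

definition complex_ring :: "complex ring" where
  "complex_ring = \<lparr>carrier = UNIV, mult = (*), one = 1, zero = 0, add = (+)\<rparr>"

definition is_basis :: "(complex, 'e) module \<Rightarrow> nat \<Rightarrow> (nat \<Rightarrow> 'e) \<Rightarrow> bool" where
  "is_basis F q e \<longleftrightarrow> (\<forall>k<q. e k \<in> carrier F) \<and>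
     (\<forall>v\<in>carrier F. \<exists>!c. c \<in> extensional {..<q} \<and> v = (\<Oplus>\<^bsub>F\<^esub>k\<in>{..<q}. c k \<odot>\<^bsub>F\<^esub> e k))"

definition dual_basis :: "(complex, 'e) module \<Rightarrow> nat \<Rightarrow> (nat \<Rightarrow> 'e) \<Rightarrow> nat \<Rightarrow> 'e \<Rightarrow> complex" where
  "dual_basis F q e i = (\<lambda>v\<in>carrier F.
     (THE c. c \<in> extensional {..<q} \<and> v = (\<Oplus>\<^bsub>F\<^esub>k\<in>{..<q}. c k \<odot>\<^bsub>F\<^esub> e k)) i)"

text \<open>
  The holomorphic structure of a bundle is given by local frames \<open>(U, e)\<close>, where \<open>e 0, \<dots>, e (q - 1)\<close>
  are sections over \<open>U\<close> that form a basis of each fibre.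
\<close>

record ('a, 'e) vbundle =
  vrank :: nat
  fib :: "'a \<Rightarrow> (complex, 'e) module"
  frames :: "('a set \<times> (nat \<Rightarrow> 'a \<Rightarrow> 'e)) set"

definition coframe :: "('a, 'e) vbundle \<Rightarrow> (nat \<Rightarrow> 'a \<Rightarrow> 'e) \<Rightarrow> nat \<Rightarrow> 'a \<Rightarrow> 'e \<Rightarrow> complex" where
  "coframe E e i y = dual_basis (fib E y) (vrank E) (\<lambda>k. e k y) i"

definition holomorphic_vbundle ::
  "('a, 'b) cmanifold_scheme \<Rightarrow> ('a, 'e) vbundle \<Rightarrow> bool" where
  "holomorphic_vbundle M E \<longleftrightarrow>
     (\<forall>y\<in>points M. Module.module complex_ring (fib E y)) \<and>
     (\<forall>(U, e)\<in>frames E. openin (mtop M) U \<and>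
        (\<forall>y\<in>U. is_basis (fib E y) (vrank E) (\<lambda>k. e k y))) \<and>
     (\<Union>(U, e)\<in>frames E. U) = points M \<and>
     (\<forall>(U, e)\<in>frames E. \<forall>(V, f)\<in>frames E. \<forall>i<vrank E. \<forall>k<vrank E.
        hol_fun M (U \<inter> V) (\<lambda>y. coframe E e i y (f k y)))"

definition pullback_bundle ::
  "('x, 'c) cmanifold_scheme \<Rightarrow> ('x \<Rightarrow> 'y) \<Rightarrow> ('y, 'e) vbundle \<Rightarrow> ('x, 'e) vbundle" where
  "pullback_bundle X i E = \<lparr>vrank = vrank E, fib = (\<lambda>x. fib E (i x)),
     frames = {(preim X i U, \<lambda>k x. e k (i x)) | U e. (U, e) \<in> frames E}\<rparr>"

definition bundle_surjection ::
  "('x, 'c) cmanifold_scheme \<Rightarrow> ('x, 'e) vbundle \<Rightarrow> ('x, 'f) vbundle \<Rightarrow> ('x \<Rightarrow> 'e \<Rightarrow> 'f) \<Rightarrow> bool" where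
  "bundle_surjection X E F \<rho> \<longleftrightarrow>
     (\<forall>x\<in>points X. \<rho> x ` carrier (fib E x) = carrier (fib F x) \<and>
        (\<forall>v\<in>carrier (fib E x). \<forall>w\<in>carrier (fib E x).
           \<rho> x (v \<oplus>\<^bsub>fib E x\<^esub> w) = \<rho> x v \<oplus>\<^bsub>fib F x\<^esub> \<rho> x w) \<and>
        (\<forall>c. \<forall>v\<in>carrier (fib E x). \<rho> x (c \<odot>\<^bsub>fib E x\<^esub> v) = c \<odot>\<^bsub>fib F x\<^esub> \<rho> x v)) \<and>
     (\<forall>(U, e)\<in>frames E. \<forall>(V, f)\<in>frames F. \<forall>k<vrank E. \<forall>i<vrank F.
        hol_fun X (U \<inter> V) (\<lambda>x. coframe F f i x (\<rho> x (e k x))))"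


section \<open>The sheaf of exterior algebras\<close>

definition dual_space :: "(complex, 'e) module \<Rightarrow> ('e \<Rightarrow> complex) set" where
  "dual_space F = {\<phi> \<in> extensional (carrier F).
     (\<forall>v\<in>carrier F. \<forall>w\<in>carrier F. \<phi> (v \<oplus>\<^bsub>F\<^esub> w) = \<phi> v + \<phi> w) \<and>
     (\<forall>c. \<forall>v\<in>carrier F. \<phi> (c \<odot>\<^bsub>F\<^esub> v) = c * \<phi> v)}"

text \<open>
  For a finite-dimensional space \<open>F\<close>, the \<open>k\<close>-th exterior power is the space of alternating
  \<open>k\<close>-linear forms on the dual of \<open>F\<close>; the product of vectors \<open>v\<^sub>1, \<dots>, v\<^sub>k\<close> is the form that sends
  \<open>[\<phi>\<^sub>1, \<dots>, \<phi>\<^sub>k]\<close> to the determinant of the matrix of the \<open>\<phi>\<^sub>i v\<^sub>j\<close>.  A form in all degrees at once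
  is a function on lists of functionals whose component of degree \<open>k\<close> is its restriction to the lists
  of length \<open>k\<close>; the components above the dimension of \<open>F\<close> vanish, so this is the direct sum.  The
  empty list gives the component of degree \<open>0\<close>.
\<close>

type_synonym 'e form = "('e \<Rightarrow> complex) list \<Rightarrow> complex"

definition forms :: "(complex, 'e) module \<Rightarrow> 'e form set" where
  "forms F = {\<omega>.
     (\<forall>l. \<not> set l \<subseteq> dual_space F \<longrightarrow> \<omega> l = 0) \<and>
     (\<forall>l r. \<forall>\<phi>\<in>dual_space F. \<forall>\<psi>\<in>dual_space F. set l \<union> set r \<subseteq> dual_space F \<longrightarrow>
        \<omega> (l @ (\<lambda>v\<in>carrier F. \<phi> v + \<psi> v) # r) = \<omega> (l @ \<phi> # r) + \<omega> (l @ \<psi> # r)) \<and>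
     (\<forall>l r c. \<forall>\<phi>\<in>dual_space F. set l \<union> set r \<subseteq> dual_space F \<longrightarrow>
        \<omega> (l @ (\<lambda>v\<in>carrier F. c * \<phi> v) # r) = c * \<omega> (l @ \<phi> # r)) \<and>
     (\<forall>l. \<not> distinct l \<longrightarrow> \<omega> l = 0)}"

text \<open>
  The shuffle product: \<open>S\<close> is the set of positions passed to \<open>\<omega>\<close>, and the sign is that of the
  permutation that moves these positions to the front.
\<close>

definition wedge :: "'e form \<Rightarrow> 'e form \<Rightarrow> 'e form" where
  "wedge \<omega> \<eta> = (\<lambda>l. \<Sum>S\<in>Pow {..<length l}.
     (-1) ^ card {(i, j). i < j \<and> j < length l \<and> i \<notin> S \<and> j \<in> S} *
     \<omega> (nths l S) * \<eta> (nths l (- S)))"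

text \<open>A model: a complex manifold with a holomorphic vector bundle.\<close>

record ('a, 'e) model = "'a cmanifold" +
  odd_bundle :: "('a, 'e) vbundle"

definition is_model :: "('a, 'e) model \<Rightarrow> bool" where
  "is_model M \<longleftrightarrow> complex_manifold M \<and> holomorphic_vbundle M (odd_bundle M)"

type_synonym ('a, 'e) ext_section = "'a \<Rightarrow> 'e form"

text \<open>
  Holomorphic sections over \<open>V\<close> of the exterior algebra bundle: the values on the dual basis vectors of
  a local frame are the coefficients with respect to the wedge monomials of the frame.
\<close>

definition ext_sections :: "('a, 'e) model \<Rightarrow> 'a set \<Rightarrow> ('a, 'e) ext_section set" where
  "ext_sections M V = {s \<in> extensional V. (\<forall>y\<in>V. s y \<in> forms (fib (odd_bundle M) y)) \<and>
     (\<forall>(W, e)\<in>frames (odd_bundle M). \<forall>is. set is \<subseteq> {..<vrank (odd_bundle M)} \<longrightarrow>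
        hol_fun M (V \<inter> W) (\<lambda>y. s y (map (\<lambda>i. coframe (odd_bundle M) e i y) is)))}"

definition ext_alg :: "('a, 'e) model \<Rightarrow> 'a set \<Rightarrow> ('a, 'e) ext_section ring" where
  "ext_alg M V = \<lparr>carrier = ext_sections M V,
     mult = (\<lambda>s t. \<lambda>y\<in>V. wedge (s y) (t y)),
     one = (\<lambda>y\<in>V. \<lambda>l. if l = [] then 1 else 0),
     zero = (\<lambda>y\<in>V. \<lambda>l. 0),
     add = (\<lambda>s t. \<lambda>y\<in>V. \<lambda>l. s y l + t y l)\<rparr>"

definition ext_scale :: "'a set \<Rightarrow> complex \<Rightarrow> ('a, 'e) ext_section \<Rightarrow> ('a, 'e) ext_section" where
  "ext_scale V c s = (\<lambda>y\<in>V. \<lambda>l. c * s y l)"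

definition ext_even :: "'a set \<Rightarrow> ('a, 'e) ext_section \<Rightarrow> bool" where
  "ext_even V s \<longleftrightarrow> (\<forall>y\<in>V. \<forall>l. odd (length l) \<longrightarrow> s y l = 0)"

definition ext_odd :: "'a set \<Rightarrow> ('a, 'e) ext_section \<Rightarrow> bool" where
  "ext_odd V s \<longleftrightarrow> (\<forall>y\<in>V. \<forall>l. even (length l) \<longrightarrow> s y l = 0)"


section \<open>The sheaves of automorphisms\<close>

abbreviation opens_in :: "('a, 'b) cmanifold_scheme \<Rightarrow> 'a set \<Rightarrow> 'a set set" where
  "opens_in M U \<equiv> {V. openin (mtop M) V \<and> V \<subseteq> U}"

type_synonym ('a, 'e) ext_aut = "'a set \<Rightarrow> ('a, 'e) ext_section \<Rightarrow> ('a, 'e) ext_section"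

text \<open>
  An automorphism over \<open>U\<close> is an automorphism of the sheaf of algebras over \<open>U\<close>, that is, a family
  indexed by the open subsets of \<open>U\<close> that commutes with restriction.  The last condition says that
  \<open>\<alpha>(s) - s\<close> has components only in degrees \<open>k \<ge> j\<close>.
\<close>

definition aut_carrier :: "('a, 'e) model \<Rightarrow> enat \<Rightarrow> 'a set \<Rightarrow> ('a, 'e) ext_aut set" where
  "aut_carrier M j U = {\<alpha> \<in> extensional (opens_in M U).
     \<forall>V\<in>opens_in M U.
       \<alpha> V \<in> extensional (ext_sections M V) \<and>
       \<alpha> V \<in> ring_iso (ext_alg M V) (ext_alg M V) \<and>
       (\<forall>s\<in>ext_sections M V.
          (\<forall>c. \<alpha> V (ext_scale V c s) = ext_scale V c (\<alpha> V s)) \<and>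
          (ext_even V s \<longrightarrow> ext_even V (\<alpha> V s)) \<and>
          (ext_odd V s \<longrightarrow> ext_odd V (\<alpha> V s)) \<and>
          (\<forall>V'\<in>opens_in M V. \<alpha> V' (restrict s V') = restrict (\<alpha> V s) V') \<and>
          (\<forall>y\<in>V. \<forall>l. enat (length l) < j \<longrightarrow> \<alpha> V s y l = s y l))}"

definition aut_sheaf :: "('a, 'e) model \<Rightarrow> enat \<Rightarrow> 'a set \<Rightarrow> ('a, 'e) ext_aut monoid" where
  "aut_sheaf M j U = \<lparr>carrier = aut_carrier M j U,
     mult = (\<lambda>\<alpha> \<beta>. \<lambda>V\<in>opens_in M U. compose (ext_sections M V) (\<alpha> V) (\<beta> V)),
     one = (\<lambda>V\<in>opens_in M U. \<lambda>s\<in>ext_sections M V. s)\<rparr>"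

definition aut_restrict :: "('a, 'e) model \<Rightarrow> 'a set \<Rightarrow> ('a, 'e) ext_aut \<Rightarrow> ('a, 'e) ext_aut" where
  "aut_restrict M V \<alpha> = restrict \<alpha> (opens_in M V)"


section \<open>Non-abelian Cech cohomology\<close>

text \<open>
  For a presheaf of groups \<open>G\<close> with restriction maps \<open>res V : G U \<Rightarrow> G V\<close>.  A cochain \<open>(I, U, g)\<close>
  consists of an open cover \<open>(U i)\<close>, \<open>i \<in> I\<close>, and of elements \<open>g i k\<close> over \<open>U i \<inter> U k\<close>.  Covers are
  indexed by sets of points; as every open cover has a refinement indexed by the points of the space,
  this computes the colimit over all open covers.
\<close>

type_synonym ('a, 'g) cochain = "'a set \<times> ('a \<Rightarrow> 'a set) \<times> ('a \<Rightarrow> 'a \<Rightarrow> 'g)"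

definition open_cover :: "'a topology \<Rightarrow> 'i set \<Rightarrow> ('i \<Rightarrow> 'a set) \<Rightarrow> bool" where
  "open_cover T I U \<longleftrightarrow> (\<forall>i\<in>I. openin T (U i)) \<and> (\<Union>i\<in>I. U i) = topspace T"

definition cocycles ::
  "'a topology \<Rightarrow> ('a set \<Rightarrow> 'g monoid) \<Rightarrow> ('a set \<Rightarrow> 'g \<Rightarrow> 'g) \<Rightarrow> ('a, 'g) cochain set" where
  "cocycles T G res = {(I, U, g). open_cover T I U \<and>
     (\<forall>i\<in>I. \<forall>k\<in>I. g i k \<in> carrier (G (U i \<inter> U k))) \<and>
     (\<forall>i\<in>I. \<forall>k\<in>I. \<forall>m\<in>I. let W = U i \<inter> U k \<inter> U m in
        res W (g i k) \<otimes>\<^bsub>G W\<^esub> res W (g k m) = res W (g i m))}"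

text \<open>
  Two cocycles are cohomologous if on a common refinement \<open>g' k m = \<mu> k \<cdot> g k m \<cdot> (\<mu> m)\<^sup>-\<^sup>1\<close>.
\<close>

definition cohomologous ::
  "'a topology \<Rightarrow> ('a set \<Rightarrow> 'g monoid) \<Rightarrow> ('a set \<Rightarrow> 'g \<Rightarrow> 'g) \<Rightarrow> ('a, 'g) cochain rel" where
  "cohomologous T G res = {((I, U, g), (I', U', g')).
     (I, U, g) \<in> cocycles T G res \<and> (I', U', g') \<in> cocycles T G res \<and>
     (\<exists>(K :: 'a set) W \<tau> \<tau>' \<mu>. open_cover T K W \<and>
        (\<forall>k\<in>K. \<tau> k \<in> I \<and> W k \<subseteq> U (\<tau> k) \<and> \<tau>' k \<in> I' \<and> W k \<subseteq> U' (\<tau>' k) \<and>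
           \<mu> k \<in> carrier (G (W k))) \<and>
        (\<forall>k\<in>K. \<forall>m\<in>K. let V = W k \<inter> W m in
           res V (g' (\<tau>' k) (\<tau>' m)) \<otimes>\<^bsub>G V\<^esub> res V (\<mu> m) =
           res V (\<mu> k) \<otimes>\<^bsub>G V\<^esub> res V (g (\<tau> k) (\<tau> m))))}"

definition cech_H1 ::
  "'a topology \<Rightarrow> ('a set \<Rightarrow> 'g monoid) \<Rightarrow> ('a set \<Rightarrow> 'g \<Rightarrow> 'g) \<Rightarrow> ('a, 'g) cochain set set" where
  "cech_H1 T G res = cocycles T G res // cohomologous T G res"

definition cech_class ::
  "'a topology \<Rightarrow> ('a set \<Rightarrow> 'g monoid) \<Rightarrow> ('a set \<Rightarrow> 'g \<Rightarrow> 'g) \<Rightarrow> ('a, 'g) cochain \<Rightarrow>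
     ('a, 'g) cochain set" where
  "cech_class T G res z = cohomologous T G res `` {z}"

text \<open>
  The base-point is the class of the trivial cocycle, written here on the cover in which every point
  indexes the whole space.
\<close>

definition cech_base ::
  "'a topology \<Rightarrow> ('a set \<Rightarrow> 'g monoid) \<Rightarrow> ('a set \<Rightarrow> 'g \<Rightarrow> 'g) \<Rightarrow> ('a, 'g) cochain set" where
  "cech_base T G res =
     cech_class T G res (topspace T, \<lambda>_. topspace T, \<lambda>_ _. \<one>\<^bsub>G (topspace T)\<^esub>)"

text \<open>
  The map induced on classes by a relation that lifts to each cocycle of the source at least one cocycle
  of the target.
\<close>

definition cech_map ::
  "'b topology \<Rightarrow> ('b set \<Rightarrow> 'h monoid) \<Rightarrow> ('b set \<Rightarrow> 'h \<Rightarrow> 'h) \<Rightarrow>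
     (('a, 'g) cochain \<times> ('b, 'h) cochain) set \<Rightarrow> ('a, 'g) cochain set \<Rightarrow> ('b, 'h) cochain set" where
  "cech_map T G res r C = cohomologous T G res `` (r `` C)"


section \<open>Supermanifolds\<close>

type_synonym ('a, 'e) ext_cochain = "('a, ('a, 'e) ext_aut) cochain"

abbreviation aut_cocycles :: "('a, 'e) model \<Rightarrow> enat \<Rightarrow> ('a, 'e) ext_cochain set" where
  "aut_cocycles M j \<equiv> cocycles (mtop M) (aut_sheaf M j) (aut_restrict M)"

abbreviation aut_H1 :: "('a, 'e) model \<Rightarrow> enat \<Rightarrow> ('a, 'e) ext_cochain set set" where
  "aut_H1 M j \<equiv> cech_H1 (mtop M) (aut_sheaf M j) (aut_restrict M)"

abbreviation aut_class ::
  "('a, 'e) model \<Rightarrow> enat \<Rightarrow> ('a, 'e) ext_cochain \<Rightarrow> ('a, 'e) ext_cochain set" where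
  "aut_class M j Z \<equiv> cech_class (mtop M) (aut_sheaf M j) (aut_restrict M) Z"

abbreviation aut_base :: "('a, 'e) model \<Rightarrow> enat \<Rightarrow> ('a, 'e) ext_cochain set" where
  "aut_base M j \<equiv> cech_base (mtop M) (aut_sheaf M j) (aut_restrict M)"

text \<open>
  The map to level \<open>k\<close> induced by the inclusion of sheaves, for classes of level \<open>j \<ge> k\<close>.
\<close>

definition level_map ::
  "('a, 'e) model \<Rightarrow> enat \<Rightarrow> ('a, 'e) ext_cochain set \<Rightarrow> ('a, 'e) ext_cochain set" where
  "level_map M k C = cech_map (mtop M) (aut_sheaf M k) (aut_restrict M) Id C"

text \<open>
  \<open>Z\<close> is a supermanifold of splitting type \<open>j\<close>.  The last clause says that it does not have splitting
  type \<open>j + 1\<close>; as the sheaf is trivial in levels above the rank, it leaves \<open>j = \<infinity>\<close> as the only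
  splitting type above the rank.
\<close>

definition supermanifold :: "('a, 'e) model \<Rightarrow> enat \<Rightarrow> ('a, 'e) ext_cochain \<Rightarrow> bool" where
  "supermanifold M j Z \<longleftrightarrow> is_model M \<and> 2 \<le> j \<and> Z \<in> aut_cocycles M j \<and>
     (j \<noteq> \<infinity> \<longrightarrow> \<not> (\<exists>C\<in>aut_H1 M (j + 1). level_map M j C = aut_class M j Z))"

definition weakly_non_split :: "('a, 'e) model \<Rightarrow> enat \<Rightarrow> ('a, 'e) ext_cochain \<Rightarrow> bool" where
  "weakly_non_split M j Z \<longleftrightarrow> aut_class M j Z \<noteq> aut_base M j \<and>
     (\<forall>k. 2 \<le> k \<and> k < j \<longrightarrow> level_map M k (aut_class M j Z) \<noteq> aut_base M k)"


section \<open>Embeddings\<close>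

definition model_embedding ::
  "('x, 'e) model \<Rightarrow> ('y, 'f) model \<Rightarrow> ('x \<Rightarrow> 'y) \<Rightarrow> ('x \<Rightarrow> 'f \<Rightarrow> 'e) \<Rightarrow> bool" where
  "model_embedding X Y i \<rho> \<longleftrightarrow> is_model X \<and> is_model Y \<and> submanifold_inclusion X Y i \<and>
     bundle_surjection X (pullback_bundle X i (odd_bundle Y)) (odd_bundle X) \<rho>"

text \<open>
  The restriction map of exterior algebras: the functional \<open>\<phi>\<close> on a fibre over \<open>X\<close> is composed with
  the surjection \<open>\<rho>\<close>.
\<close>

definition ext_pull ::
  "('x, 'e) model \<Rightarrow> ('y, 'f) model \<Rightarrow> ('x \<Rightarrow> 'y) \<Rightarrow> ('x \<Rightarrow> 'f \<Rightarrow> 'e) \<Rightarrow>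
     'y set \<Rightarrow> ('y, 'f) ext_section \<Rightarrow> ('x, 'e) ext_section" where
  "ext_pull X Y i \<rho> V s = (\<lambda>x\<in>preim X i V. \<lambda>l.
     if set l \<subseteq> dual_space (fib (odd_bundle X) x)
     then s (i x) (map (\<lambda>\<phi>. \<lambda>v\<in>carrier (fib (odd_bundle Y) (i x)). \<phi> (\<rho> x v)) l)
     else 0)"

definition aut_restricts_to ::
  "('x, 'e) model \<Rightarrow> ('y, 'f) model \<Rightarrow> ('x \<Rightarrow> 'y) \<Rightarrow> ('x \<Rightarrow> 'f \<Rightarrow> 'e) \<Rightarrow> 'y set \<Rightarrow>
     ('y, 'f) ext_aut \<Rightarrow> ('x, 'e) ext_aut \<Rightarrow> bool" where
  "aut_restricts_to X Y i \<rho> U \<alpha> \<beta> \<longleftrightarrow>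
     (\<forall>V\<in>opens_in Y U. \<forall>s\<in>ext_sections Y V.
        \<beta> (preim X i V) (ext_pull X Y i \<rho> V s) = ext_pull X Y i \<rho> V (\<alpha> V s))"

definition rel_aut_sheaf ::
  "('x, 'e) model \<Rightarrow> ('y, 'f) model \<Rightarrow> ('x \<Rightarrow> 'y) \<Rightarrow> ('x \<Rightarrow> 'f \<Rightarrow> 'e) \<Rightarrow> enat \<Rightarrow> 'y set \<Rightarrow>
     ('y, 'f) ext_aut monoid" where
  "rel_aut_sheaf X Y i \<rho> j U = (aut_sheaf Y j U)\<lparr>carrier :=
     {\<alpha> \<in> aut_carrier Y j U.
        \<exists>\<beta>\<in>aut_carrier X j (preim X i U). aut_restricts_to X Y i \<rho> U \<alpha> \<beta>}\<rparr>"

abbreviation rel_H1 ::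
  "('x, 'e) model \<Rightarrow> ('y, 'f) model \<Rightarrow> ('x \<Rightarrow> 'y) \<Rightarrow> ('x \<Rightarrow> 'f \<Rightarrow> 'e) \<Rightarrow> enat \<Rightarrow>
     ('y, 'f) ext_cochain set set" where
  "rel_H1 X Y i \<rho> j \<equiv> cech_H1 (mtop Y) (rel_aut_sheaf X Y i \<rho> j) (aut_restrict Y)"

abbreviation rel_base ::
  "('x, 'e) model \<Rightarrow> ('y, 'f) model \<Rightarrow> ('x \<Rightarrow> 'y) \<Rightarrow> ('x \<Rightarrow> 'f \<Rightarrow> 'e) \<Rightarrow> enat \<Rightarrow>
     ('y, 'f) ext_cochain set" where
  "rel_base X Y i \<rho> j \<equiv> cech_base (mtop Y) (rel_aut_sheaf X Y i \<rho> j) (aut_restrict Y)"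

definition u_map ::
  "('y, 'f) model \<Rightarrow> enat \<Rightarrow> ('y, 'f) ext_cochain set \<Rightarrow> ('y, 'f) ext_cochain set" where
  "u_map Y j C = cech_map (mtop Y) (aut_sheaf Y j) (aut_restrict Y) Id C"

text \<open>
  A cocycle \<open>(K, W, h)\<close> on \<open>X\<close> is a restriction of \<open>(I, U, g)\<close> if its cover refines the cover by the
  preimages of the \<open>U i\<close>, by way of \<open>\<tau>\<close>, and \<open>h\<close> consists of the restrictions of the \<open>g i k\<close>.
\<close>

definition restricted_cochain ::
  "('x, 'e) model \<Rightarrow> ('y, 'f) model \<Rightarrow> ('x \<Rightarrow> 'y) \<Rightarrow> ('x \<Rightarrow> 'f \<Rightarrow> 'e) \<Rightarrow> enat \<Rightarrow>
     (('y, 'f) ext_cochain \<times> ('x, 'e) ext_cochain) set" where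
  "restricted_cochain X Y i \<rho> j = {((I, U, g), (K, W, h)).
     open_cover (mtop X) K W \<and>
     (\<exists>\<tau>. (\<forall>k\<in>K. \<tau> k \<in> I \<and> W k \<subseteq> preim X i (U (\<tau> k))) \<and>
       (\<forall>k\<in>K. \<forall>m\<in>K. let V = U (\<tau> k) \<inter> U (\<tau> m) in
          \<exists>\<beta>\<in>aut_carrier X j (preim X i V).
            aut_restricts_to X Y i \<rho> V (g (\<tau> k) (\<tau> m)) \<beta> \<and>
            h k m = aut_restrict X (W k \<inter> W m) \<beta>))}"

definition r_map ::
  "('x, 'e) model \<Rightarrow> ('y, 'f) model \<Rightarrow> ('x \<Rightarrow> 'y) \<Rightarrow> ('x \<Rightarrow> 'f \<Rightarrow> 'e) \<Rightarrow> enat \<Rightarrow>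
     ('y, 'f) ext_cochain set \<Rightarrow> ('x, 'e) ext_cochain set" where
  "r_map X Y i \<rho> j C =
     cech_map (mtop X) (aut_sheaf X j) (aut_restrict X) (restricted_cochain X Y i \<rho> j) C"

text \<open>
  \<open>c\<close> is an embedding of splitting type \<open>(j'', j, j')\<close> of \<open>Z\<close> (of splitting type \<open>j\<close>, modelled on \<open>X\<close>)
  in \<open>Z'\<close> (of splitting type \<open>j'\<close>, modelled on \<open>Y\<close>).
\<close>

definition super_embedding ::
  "('x, 'e) model \<Rightarrow> ('y, 'f) model \<Rightarrow> ('x \<Rightarrow> 'y) \<Rightarrow> ('x \<Rightarrow> 'f \<Rightarrow> 'e) \<Rightarrow>
     ('x, 'e) ext_cochain \<Rightarrow> ('y, 'f) ext_cochain \<Rightarrow> enat \<Rightarrow> enat \<Rightarrow> enat \<Rightarrow>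
     ('y, 'f) ext_cochain set \<Rightarrow> bool" where
  "super_embedding X Y i \<rho> Z Z' j'' j j' c \<longleftrightarrow>
     model_embedding X Y i \<rho> \<and> supermanifold X j Z \<and> supermanifold Y j' Z' \<and>
     2 \<le> j'' \<and> j'' \<le> j \<and> j'' \<le> j' \<and> c \<in> rel_H1 X Y i \<rho> j'' \<and>
     r_map X Y i \<rho> j'' c = level_map X j'' (aut_class X j Z) \<and>
     u_map Y j'' c = level_map Y j'' (aut_class Y j' Z')"


section \<open>Families and splitting type deformations\<close>

definition hol_alg :: "('b, 'd) cmanifold_scheme \<Rightarrow> 'b set \<Rightarrow> ('b \<Rightarrow> complex) ring" where
  "hol_alg B W = \<lparr>carrier = {h \<in> extensional W. hol_fun B W h},
     mult = (\<lambda>h k. \<lambda>b\<in>W. h b * k b), one = (\<lambda>b\<in>W. 1),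
     zero = (\<lambda>b\<in>W. 0), add = (\<lambda>h k. \<lambda>b\<in>W. h b + k b)\<rparr>"

text \<open>
  The structure sheaf of the supermanifold \<open>(I, U, g)\<close>: sections \<open>s i\<close> over the \<open>U i\<close>, glued by
  \<open>s i = g i k (s k)\<close>.
\<close>

definition structure_alg ::
  "('a, 'e) model \<Rightarrow> ('a, 'e) ext_cochain \<Rightarrow> 'a set \<Rightarrow> ('a \<Rightarrow> ('a, 'e) ext_section) ring" where
  "structure_alg M = (\<lambda>(I, U, g) V. \<lparr>
     carrier = {s \<in> (\<Pi>\<^sub>E i\<in>I. ext_sections M (V \<inter> U i)).
       \<forall>i\<in>I. \<forall>k\<in>I. let W = V \<inter> (U i \<inter> U k) in
         restrict (s i) W = g i k W (restrict (s k) W)},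
     mult = (\<lambda>s t. \<lambda>i\<in>I. s i \<otimes>\<^bsub>ext_alg M (V \<inter> U i)\<^esub> t i),
     one = (\<lambda>i\<in>I. \<one>\<^bsub>ext_alg M (V \<inter> U i)\<^esub>),
     zero = (\<lambda>i\<in>I. \<zero>\<^bsub>ext_alg M (V \<inter> U i)\<^esub>),
     add = (\<lambda>s t. \<lambda>i\<in>I. s i \<oplus>\<^bsub>ext_alg M (V \<inter> U i)\<^esub> t i)\<rparr>)"

text \<open>
  A morphism from the supermanifold \<open>(I, U, g)\<close> to the complex manifold \<open>B\<close>: a continuous map \<open>p\<close> with
  parity-preserving algebra morphisms \<open>f W\<close> from the holomorphic functions on \<open>W\<close> to the structure
  sheaf over the preimage of \<open>W\<close>.  The last condition says that the reduced part is \<open>p\<close>: the component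
  of degree \<open>0\<close> of \<open>f W h\<close> is \<open>h \<circ> p\<close>.
\<close>

definition super_morphism ::
  "('a, 'e) model \<Rightarrow> ('a, 'e) ext_cochain \<Rightarrow> 'b cmanifold \<Rightarrow> ('a \<Rightarrow> 'b) \<Rightarrow>
     ('b set \<Rightarrow> ('b \<Rightarrow> complex) \<Rightarrow> 'a \<Rightarrow> ('a, 'e) ext_section) \<Rightarrow> bool" where
  "super_morphism M = (\<lambda>(I, U, g) B p f.
     continuous_map (mtop M) (mtop B) p \<and>
     (\<forall>W. openin (mtop B) W \<longrightarrow>
        f W \<in> ring_hom (hol_alg B W) (structure_alg M (I, U, g) (preim M p W)) \<and>
        (\<forall>h\<in>carrier (hol_alg B W). \<forall>i\<in>I.
           ext_even (preim M p W \<inter> U i) (f W h i) \<and>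
           (\<forall>c. f W (\<lambda>b\<in>W. c * h b) i = ext_scale (preim M p W \<inter> U i) c (f W h i)) \<and>
           (\<forall>W'\<in>opens_in B W.
              f W' (restrict h W') i = restrict (f W h i) (preim M p W' \<inter> U i)) \<and>
           (\<forall>y\<in>preim M p W \<inter> U i. f W h i y [] = h (p y)))))"

text \<open>
  The data of a family modelled on \<open>fibre_model\<close>: the total space with its splitting type, the
  morphism to the base, and for each point of the base the fibre, its splitting type \<open>j\<^sub>b\<close>, the
  embedding of models, the level \<open>j''\<^sub>b\<close> and the class \<open>c\<^sub>b\<close> of the embedding.
\<close>

record ('b, 'x, 'e, 'y, 'f) super_family =
  base :: "'b cmanifold"
  fibre_model :: "('x, 'e) model"
  total_model :: "('y, 'f) model"
  total_space :: "('y, 'f) ext_cochain"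
  total_type :: enat
  proj :: "'y \<Rightarrow> 'b"
  proj_alg :: "'b set \<Rightarrow> ('b \<Rightarrow> complex) \<Rightarrow> 'y \<Rightarrow> ('y, 'f) ext_section"
  fibre :: "'b \<Rightarrow> ('x, 'e) ext_cochain"
  fibre_type :: "'b \<Rightarrow> enat"
  incl :: "'b \<Rightarrow> 'x \<Rightarrow> 'y"
  surj_map :: "'b \<Rightarrow> 'x \<Rightarrow> 'f \<Rightarrow> 'e"
  embed_type :: "'b \<Rightarrow> enat"
  embed_class :: "'b \<Rightarrow> ('y, 'f) ext_cochain set"

text \<open>
  The last clause says that the embedded reduced space is the reduced fibre over \<open>b\<close>, so that
  \<open>fibre F b\<close> is the fibre over \<open>b\<close>.
\<close>

definition family :: "('b, 'x, 'e, 'y, 'f) super_family \<Rightarrow> bool" where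
  "family F \<longleftrightarrow>
     complex_manifold (base F) \<and> is_model (fibre_model F) \<and>
     supermanifold (total_model F) (total_type F) (total_space F) \<and>
     super_morphism (total_model F) (total_space F) (base F) (proj F) (proj_alg F) \<and>
     analytic_family (total_model F) (base F) (proj F) \<and>
     (\<forall>b\<in>points (base F).
        super_embedding (fibre_model F) (total_model F) (incl F b) (surj_map F b)
          (fibre F b) (total_space F) (embed_type F b) (fibre_type F b) (total_type F)
          (embed_class F b) \<and>
        incl F b ` points (fibre_model F) = preim (total_model F) (proj F) {b})"

definition splitting_type_deformation :: "('b, 'x, 'e, 'y, 'f) super_family \<Rightarrow> 'b \<Rightarrow> bool" where
  "splitting_type_deformation F b\<^sub>0 \<longleftrightarrow> family F \<and> b\<^sub>0 \<in> points (base F)"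

definition classifying_map ::
  "('b, 'x, 'e, 'y, 'f) super_family \<Rightarrow> 'b \<Rightarrow> ('y, 'f) ext_cochain set" where
  "classifying_map F = (\<lambda>b\<in>points (base F). embed_class F b)"

definition classifying_map_pointed :: "('b, 'x, 'e, 'y, 'f) super_family \<Rightarrow> 'b \<Rightarrow> bool" where
  "classifying_map_pointed F b\<^sub>0 \<longleftrightarrow> classifying_map F b\<^sub>0 =
     rel_base (fibre_model F) (total_model F) (incl F b\<^sub>0) (surj_map F b\<^sub>0) (embed_type F b\<^sub>0)"

end

theory Submission
  imports Defs "HOL-Algebra.Bij"
begin

text \<open>
  The map \<open>u\<^sub>*\<close> sends the base-point of the relative cohomology set to the base-point at level
  \<open>k = j''\<close> of the distinguished fibre.  If \<open>c\<close> at the distinguished point is the base-point, then the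
  class of the total space is trivial at level \<open>k \<le> j'\<close>; for \<open>k < j'\<close> this contradicts the second
  condition of weak non-splitness, and for \<open>k = j'\<close> the first.  The work lies in showing that being
  cohomologous is an equivalence relation for the sheaves of automorphisms.
\<close>

section \<open>Cohomologous cocycles\<close>

text \<open>Classes and induced maps are relation images: \<open>level_map\<close> and
  \<open>u_map\<close> produce unions of classes, which collapse to one class only if
  \<open>cohomologous\<close> is an equivalence relation, and this in turn needs group laws for the
  automorphisms. The obstacle there is that closure of \<open>ext_sections\<close> under sums and
  wedge products is not part of the definitions. What is required of it is extracted from the
  existence of an automorphism: being onto and extensional, it forces each operation to stay among
  the sections or to give \<open>undefined\<close>. With that, identities, composites and inverses
  are formal, except for one condition: the inverse of a parity-preserving automorphism has to
  preserve parity. This uses the splitting of a section into its even and odd part. The group laws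
  are established for the full sheaf; the relative sheaf enters through the inclusion of its
  relation \<open>cohomologous\<close> in that of the full sheaf.\<close>

lemma cohomologousI:
  fixes T :: "'a topology" and K :: "'a set"
  assumes "(I, U, g) \<in> cocycles T G res" "(I', U', g') \<in> cocycles T G res" "open_cover T K W"
    and "\<And>k. k \<in> K \<Longrightarrow> \<tau> k \<in> I" "\<And>k. k \<in> K \<Longrightarrow> W k \<subseteq> U (\<tau> k)"
    and "\<And>k. k \<in> K \<Longrightarrow> \<tau>' k \<in> I'" "\<And>k. k \<in> K \<Longrightarrow> W k \<subseteq> U' (\<tau>' k)"
    and "\<And>k. k \<in> K \<Longrightarrow> \<mu> k \<in> carrier (G (W k))"
    and "\<And>k m V. \<lbrakk>k \<in> K; m \<in> K; V = W k \<inter> W m\<rbrakk> \<Longrightarrow>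
      res V (g' (\<tau>' k) (\<tau>' m)) \<otimes>\<^bsub>G V\<^esub> res V (\<mu> m) = res V (\<mu> k) \<otimes>\<^bsub>G V\<^esub> res V (g (\<tau> k) (\<tau> m))"
  shows "((I, U, g), (I', U', g')) \<in> cohomologous T G res"
  unfolding cohomologous_def mem_Collect_eq case_prod_conv Let_def
  by (intro conjI assms(1,2), rule exI[of _ K], rule exI[of _ W], rule exI[of _ \<tau>],
      rule exI[of _ \<tau>'], rule exI[of _ \<mu>]) (use assms(3-9) in simp)

text \<open>
  Only nonempty carriers have to be groups: for the sheaves of automorphisms, one automorphism of the
  algebra of sections is enough to obtain the group axioms.
\<close>

locale group_presheaf =
  fixes T :: "'a topology" and G :: "'a set \<Rightarrow> 'g monoid" and res :: "'a set \<Rightarrow> 'g \<Rightarrow> 'g"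
  assumes group: "\<lbrakk>openin T U; g \<in> carrier (G U)\<rbrakk> \<Longrightarrow> group (G U)"
    and res_hom: "\<lbrakk>openin T U; openin T V; V \<subseteq> U\<rbrakk> \<Longrightarrow> res V \<in> hom (G U) (G V)"
    and res_res: "\<lbrakk>openin T U; openin T V; V \<subseteq> U\<rbrakk> \<Longrightarrow> res V (res U g) = res V g"
begin

section \<open>Restriction of group elements and of cocycle identities to smaller open sets\<close>

lemma res_closed: "\<lbrakk>openin T U; openin T V; V \<subseteq> U; g \<in> carrier (G U)\<rbrakk> \<Longrightarrow> res V g \<in> carrier (G V)"
  using res_hom by (auto simp: hom_def)

lemma res_mult:
  "\<lbrakk>openin T U; openin T V; V \<subseteq> U; g \<in> carrier (G U); h \<in> carrier (G U)\<rbrakk>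
    \<Longrightarrow> res V (g \<otimes>\<^bsub>G U\<^esub> h) = res V g \<otimes>\<^bsub>G V\<^esub> res V h"
  using res_hom by (auto simp: hom_def)

lemma res_group_hom:
  assumes "openin T U" "openin T V" "V \<subseteq> U" "g \<in> carrier (G U)"
  shows "group_hom (G U) (G V) (res V)"
  using assms group res_hom res_closed unfolding group_hom_def group_hom_axioms_def by metis

text \<open>Restriction is multiplicative and transitive, so an identity on an overlap passes to
  every smaller open set. In \<open>cohomologousE\<close> the four elements live on four different
  open sets, hence the separate \<open>A\<close>, \<open>B\<close>, \<open>C\<close>,
  \<open>D\<close>.\<close>

lemma res_mult_eq:
  assumes "openin T W" "openin T V" "V \<subseteq> W"
    and "openin T A" "openin T B" "openin T C" "openin T D" "W \<subseteq> A" "W \<subseteq> B" "W \<subseteq> C" "W \<subseteq> D"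
    and "a \<in> carrier (G A)" "b \<in> carrier (G B)" "c \<in> carrier (G C)" "d \<in> carrier (G D)"
    and "res W a \<otimes>\<^bsub>G W\<^esub> res W b = res W c \<otimes>\<^bsub>G W\<^esub> res W d"
  shows "res V a \<otimes>\<^bsub>G V\<^esub> res V b = res V c \<otimes>\<^bsub>G V\<^esub> res V d"
proof -
  have "res V (res W a \<otimes>\<^bsub>G W\<^esub> res W b) = res V (res W c \<otimes>\<^bsub>G W\<^esub> res W d)"
    using assms(16) by simp
  then show ?thesis
    using assms(1-15) by (simp add: res_mult res_closed res_res)
qed

lemma cocycle_open:
  assumes "(I, U, g) \<in> cocycles T G res" "i \<in> I"
  shows "openin T (U i)"
  using assms by (auto simp: cocycles_def open_cover_def)

lemma cocycle_closed:
  assumes "(I, U, g) \<in> cocycles T G res" "i \<in> I" "k \<in> I"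
    and "openin T V" "V \<subseteq> U i" "V \<subseteq> U k"
  shows "res V (g i k) \<in> carrier (G V)"
proof (rule res_closed)
  show "openin T (U i \<inter> U k)"
    using assms cocycle_open by blast
  show "g i k \<in> carrier (G (U i \<inter> U k))"
    using assms by (auto simp: cocycles_def)
qed (use assms in auto)

lemma cocycle_mult:
  assumes z: "(I, U, g) \<in> cocycles T G res" "i \<in> I" "k \<in> I" "m \<in> I"
    and V: "openin T V" "V \<subseteq> U i" "V \<subseteq> U k" "V \<subseteq> U m"
  shows "res V (g i k) \<otimes>\<^bsub>G V\<^esub> res V (g k m) = res V (g i m)"
proof -
  let ?W = "U i \<inter> U k \<inter> U m"
  have W: "openin T ?W"
    using z cocycle_open by (metis openin_Int)
  have "res ?W (g i k) \<otimes>\<^bsub>G ?W\<^esub> res ?W (g k m) = res ?W (g i m)"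
    using z by (auto simp: cocycles_def Let_def)
  then have "res V (res ?W (g i k) \<otimes>\<^bsub>G ?W\<^esub> res ?W (g k m)) = res V (res ?W (g i m))"
    by simp
  moreover have "res ?W (g i k) \<in> carrier (G ?W)" "res ?W (g k m) \<in> carrier (G ?W)"
    using z W by (auto intro!: cocycle_closed)
  ultimately show ?thesis
    using W V by (simp add: res_mult res_res)
qed

text \<open>The cover serves as its own refinement, with identity index maps and every
  \<open>\<mu> i\<close> equal to the unit over \<open>U i\<close>.\<close>

lemma cohomologous_refl:
  assumes z: "z \<in> cocycles T G res"
  shows "(z, z) \<in> cohomologous T G res"
proof -
  obtain I U g where zdef: "z = (I, U, g)"
    by (cases z) auto
  note z = z[unfolded zdef]
  \<comment> \<open>The restriction of \<open>g i i\<close> to \<open>V\<close> is the element that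
    makes the carrier nonempty, hence \<open>G V\<close> a group.\<close>
  have grp: "group (G V)" if "openin T V" "i \<in> I" "V \<subseteq> U i" for V i
    using cocycle_closed[OF z, of i i V] group that by blast
  have one: "res V \<one>\<^bsub>G (U i)\<^esub> = \<one>\<^bsub>G V\<^esub>" if "openin T V" "i \<in> I" "V \<subseteq> U i" for V i
  proof -
    have "group (G (U i))"
      using grp that cocycle_open[OF z] by blast
    then have "\<one>\<^bsub>G (U i)\<^esub> \<in> carrier (G (U i))"
      by (simp add: group.is_monoid)
    then show ?thesis
      using res_group_hom[of "U i" V] that cocycle_open[OF z] group_hom.hom_one by blast
  qed
  have "open_cover T I U"
    using z by (simp add: cocycles_def)
  moreover have "\<one>\<^bsub>G (U i)\<^esub> \<in> carrier (G (U i))" if "i \<in> I" for i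
    using grp[of "U i" i] that cocycle_open[OF z] by (simp add: group.is_monoid)
  moreover have "res (U i \<inter> U k) (g i k) \<otimes>\<^bsub>G (U i \<inter> U k)\<^esub> res (U i \<inter> U k) \<one>\<^bsub>G (U k)\<^esub> =
      res (U i \<inter> U k) \<one>\<^bsub>G (U i)\<^esub> \<otimes>\<^bsub>G (U i \<inter> U k)\<^esub> res (U i \<inter> U k) (g i k)"
    if "i \<in> I" "k \<in> I" for i k
  proof -
    have V: "openin T (U i \<inter> U k)"
      using that cocycle_open[OF z] by blast
    then interpret group "G (U i \<inter> U k)"
      using grp[of _ i] that by blast
    show ?thesis
      using that V cocycle_closed[OF z, of i k "U i \<inter> U k"]
      by (simp add: one[of _ i] one[of _ k])
  qed
  ultimately show ?thesis
    unfolding zdef using z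
    by (intro cohomologousI[of I U g _ _ _ I U g I U "\<lambda>i. i" "\<lambda>i. i" "\<lambda>i. \<one>\<^bsub>G (U i)\<^esub>"]) simp_all
qed

text \<open>The coboundary identity is delivered on every open \<open>V\<close> inside
  \<open>W k \<inter> W m\<close>. Transitivity needs this freedom, as it refines the cover once
  more.\<close>

lemma cohomologousE:
  assumes "((I, U, g), (I', U', g')) \<in> cohomologous T G res"
  obtains K :: "'a set" and W \<tau> \<tau>' \<mu> where "open_cover T K W"
    and "\<And>k. k \<in> K \<Longrightarrow> openin T (W k)"
    and "\<And>k. k \<in> K \<Longrightarrow> \<tau> k \<in> I" "\<And>k. k \<in> K \<Longrightarrow> W k \<subseteq> U (\<tau> k)"
    and "\<And>k. k \<in> K \<Longrightarrow> \<tau>' k \<in> I'" "\<And>k. k \<in> K \<Longrightarrow> W k \<subseteq> U' (\<tau>' k)"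
    and "\<And>k. k \<in> K \<Longrightarrow> \<mu> k \<in> carrier (G (W k))"
    and "\<And>k m V. \<lbrakk>k \<in> K; m \<in> K; openin T V; V \<subseteq> W k; V \<subseteq> W m\<rbrakk> \<Longrightarrow>
      res V (g' (\<tau>' k) (\<tau>' m)) \<otimes>\<^bsub>G V\<^esub> res V (\<mu> m) = res V (\<mu> k) \<otimes>\<^bsub>G V\<^esub> res V (g (\<tau> k) (\<tau> m))"
proof -
  have z: "(I, U, g) \<in> cocycles T G res" "(I', U', g') \<in> cocycles T G res"
    using assms by (auto simp: cohomologous_def)
  obtain K :: "'a set" and W \<tau> \<tau>' \<mu> where c: "open_cover T K W"
    and h: "\<forall>k\<in>K. \<tau> k \<in> I \<and> W k \<subseteq> U (\<tau> k) \<and> \<tau>' k \<in> I' \<and> W k \<subseteq> U' (\<tau>' k) \<and>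
           \<mu> k \<in> carrier (G (W k))"
    and eq: "\<forall>k\<in>K. \<forall>m\<in>K. let V = W k \<inter> W m in
           res V (g' (\<tau>' k) (\<tau>' m)) \<otimes>\<^bsub>G V\<^esub> res V (\<mu> m) =
           res V (\<mu> k) \<otimes>\<^bsub>G V\<^esub> res V (g (\<tau> k) (\<tau> m))"
    using assms unfolding cohomologous_def by blast
  have W: "openin T (W k)" if "k \<in> K" for k
    using c that by (simp add: open_cover_def)
  have "res V (g' (\<tau>' k) (\<tau>' m)) \<otimes>\<^bsub>G V\<^esub> res V (\<mu> m) = res V (\<mu> k) \<otimes>\<^bsub>G V\<^esub> res V (g (\<tau> k) (\<tau> m))"
    if k: "k \<in> K" and m: "m \<in> K" and V: "openin T V" "V \<subseteq> W k" "V \<subseteq> W m" for k m V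
  proof (rule res_mult_eq[of "W k \<inter> W m" V "U' (\<tau>' k) \<inter> U' (\<tau>' m)" "W m" "W k" "U (\<tau> k) \<inter> U (\<tau> m)"])
    show "res (W k \<inter> W m) (g' (\<tau>' k) (\<tau>' m)) \<otimes>\<^bsub>G (W k \<inter> W m)\<^esub> res (W k \<inter> W m) (\<mu> m) =
        res (W k \<inter> W m) (\<mu> k) \<otimes>\<^bsub>G (W k \<inter> W m)\<^esub> res (W k \<inter> W m) (g (\<tau> k) (\<tau> m))"
      using eq k m by (simp add: Let_def)
    show "g' (\<tau>' k) (\<tau>' m) \<in> carrier (G (U' (\<tau>' k) \<inter> U' (\<tau>' m)))"
      using z(2) h k m by (simp add: cocycles_def)
    show "g (\<tau> k) (\<tau> m) \<in> carrier (G (U (\<tau> k) \<inter> U (\<tau> m)))"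
      using z(1) h k m by (simp add: cocycles_def)
    show "openin T (U' (\<tau>' k) \<inter> U' (\<tau>' m))" "openin T (U (\<tau> k) \<inter> U (\<tau> m))"
      using cocycle_open[OF z(1)] cocycle_open[OF z(2)] h k m by auto
    show "W k \<inter> W m \<subseteq> U' (\<tau>' k) \<inter> U' (\<tau>' m)" "W k \<inter> W m \<subseteq> U (\<tau> k) \<inter> U (\<tau> m)"
      using h k m by blast+
  qed (use h k m V W in auto)
  then show ?thesis
    using that c h W by blast
qed

text \<open>The same refinement works with each \<open>\<mu> k\<close> inverted: solving the
  identity for \<open>g'\<close> gives \<open>\<mu> k \<cdot> g \<cdot> (\<mu> m)\<close> with the
  last factor inverted, and multiplying by the inverse of \<open>\<mu> k\<close> on the left gives
  the reversed identity.\<close>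

lemma cohomologous_sym:
  assumes "(z, z') \<in> cohomologous T G res"
  shows "(z', z) \<in> cohomologous T G res"
proof -
  obtain I U g I' U' g' where zdef: "z = (I, U, g)" "z' = (I', U', g')"
    by (cases z, cases z') auto
  have z: "(I, U, g) \<in> cocycles T G res" "(I', U', g') \<in> cocycles T G res"
    using assms zdef by (auto simp: cohomologous_def)
  obtain K :: "'a set" and W \<tau> \<tau>' \<mu> where c: "open_cover T K W"
    and W: "\<And>k. k \<in> K \<Longrightarrow> openin T (W k)"
    and \<tau>: "\<And>k. k \<in> K \<Longrightarrow> \<tau> k \<in> I" "\<And>k. k \<in> K \<Longrightarrow> W k \<subseteq> U (\<tau> k)"
    and \<tau>': "\<And>k. k \<in> K \<Longrightarrow> \<tau>' k \<in> I'" "\<And>k. k \<in> K \<Longrightarrow> W k \<subseteq> U' (\<tau>' k)"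
    and \<mu>: "\<And>k. k \<in> K \<Longrightarrow> \<mu> k \<in> carrier (G (W k))"
    and eq: "\<And>k m V. \<lbrakk>k \<in> K; m \<in> K; openin T V; V \<subseteq> W k; V \<subseteq> W m\<rbrakk> \<Longrightarrow>
      res V (g' (\<tau>' k) (\<tau>' m)) \<otimes>\<^bsub>G V\<^esub> res V (\<mu> m) = res V (\<mu> k) \<otimes>\<^bsub>G V\<^esub> res V (g (\<tau> k) (\<tau> m))"
    by (rule cohomologousE[OF assms[unfolded zdef]]) blast
  define \<nu> where "\<nu> k = inv\<^bsub>G (W k)\<^esub> (\<mu> k)" for k
  have \<nu>: "\<nu> k \<in> carrier (G (W k))" if "k \<in> K" for k
    unfolding \<nu>_def by (rule group.inv_closed[OF group[OF W[OF that] \<mu>[OF that]] \<mu>[OF that]])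
  have "res V (g (\<tau> k) (\<tau> m)) \<otimes>\<^bsub>G V\<^esub> res V (\<nu> m) = res V (\<nu> k) \<otimes>\<^bsub>G V\<^esub> res V (g' (\<tau>' k) (\<tau>' m))"
    if k: "k \<in> K" and m: "m \<in> K" and V: "V = W k \<inter> W m" for k m V
  proof -
    have oV: "openin T V" "V \<subseteq> W k" "V \<subseteq> W m"
      using V W k m by auto
    have VU: "V \<subseteq> U (\<tau> k)" "V \<subseteq> U (\<tau> m)" "V \<subseteq> U' (\<tau>' k)" "V \<subseteq> U' (\<tau>' m)"
      using oV \<tau>(2)[OF k] \<tau>(2)[OF m] \<tau>'(2)[OF k] \<tau>'(2)[OF m] by auto
    have cl: "res V (\<mu> k) \<in> carrier (G V)" "res V (\<mu> m) \<in> carrier (G V)"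
        "res V (g (\<tau> k) (\<tau> m)) \<in> carrier (G V)" "res V (g' (\<tau>' k) (\<tau>' m)) \<in> carrier (G V)"
      by (rule res_closed[OF W[OF k] oV(1,2) \<mu>[OF k]], rule res_closed[OF W[OF m] oV(1,3) \<mu>[OF m]],
          rule cocycle_closed[OF z(1) \<tau>(1)[OF k] \<tau>(1)[OF m] oV(1) VU(1,2)],
          rule cocycle_closed[OF z(2) \<tau>'(1)[OF k] \<tau>'(1)[OF m] oV(1) VU(3,4)])
    interpret group "G V"
      using group oV cl by blast
    have inv: "res V (\<nu> i) = inv\<^bsub>G V\<^esub> (res V (\<mu> i))" if "i \<in> K" "V \<subseteq> W i" for i
      unfolding \<nu>_def
      using group_hom.hom_inv[OF res_group_hom[OF W[OF that(1)] oV(1) that(2) \<mu>[OF that(1)]] \<mu>[OF that(1)]] .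
    have "res V (g' (\<tau>' k) (\<tau>' m)) = res V (\<mu> k) \<otimes>\<^bsub>G V\<^esub> res V (g (\<tau> k) (\<tau> m)) \<otimes>\<^bsub>G V\<^esub> inv\<^bsub>G V\<^esub> (res V (\<mu> m))"
      using eq[OF k m oV] cl by (metis inv_solve_right' m_closed)
    then show ?thesis
      using cl inv[OF k oV(2)] inv[OF m oV(3)] by (simp add: m_assoc[symmetric])
  qed
  with z(2,1) c \<tau>' \<tau> \<nu> show ?thesis
    unfolding zdef by (rule cohomologousI)
qed

lemma cohomologous_trans:
  assumes "(z, z') \<in> cohomologous T G res" "(z', z'') \<in> cohomologous T G res"
  shows "(z, z'') \<in> cohomologous T G res"
proof -
  obtain I U g I' U' g' I'' U'' g'' where zdef: "z = (I, U, g)" "z' = (I', U', g')" "z'' = (I'', U'', g'')"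
    by (cases z, cases z', cases z'') auto
  have z: "(I, U, g) \<in> cocycles T G res" "(I', U', g') \<in> cocycles T G res"
      "(I'', U'', g'') \<in> cocycles T G res"
    using assms zdef by (auto simp: cohomologous_def)
  obtain K :: "'a set" and W \<tau> \<tau>' \<mu> where cK: "open_cover T K W"
    and W: "\<And>k. k \<in> K \<Longrightarrow> openin T (W k)"
    and \<tau>: "\<And>k. k \<in> K \<Longrightarrow> \<tau> k \<in> I" "\<And>k. k \<in> K \<Longrightarrow> W k \<subseteq> U (\<tau> k)"
    and \<tau>': "\<And>k. k \<in> K \<Longrightarrow> \<tau>' k \<in> I'" "\<And>k. k \<in> K \<Longrightarrow> W k \<subseteq> U' (\<tau>' k)"
    and \<mu>: "\<And>k. k \<in> K \<Longrightarrow> \<mu> k \<in> carrier (G (W k))"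
    and eq: "\<And>k m V. \<lbrakk>k \<in> K; m \<in> K; openin T V; V \<subseteq> W k; V \<subseteq> W m\<rbrakk> \<Longrightarrow>
      res V (g' (\<tau>' k) (\<tau>' m)) \<otimes>\<^bsub>G V\<^esub> res V (\<mu> m) = res V (\<mu> k) \<otimes>\<^bsub>G V\<^esub> res V (g (\<tau> k) (\<tau> m))"
    by (rule cohomologousE[OF assms(1)[unfolded zdef(1,2)]]) blast
  obtain L :: "'a set" and Y \<sigma> \<sigma>' \<nu> where cL: "open_cover T L Y"
    and Y: "\<And>k. k \<in> L \<Longrightarrow> openin T (Y k)"
    and \<sigma>: "\<And>k. k \<in> L \<Longrightarrow> \<sigma> k \<in> I'" "\<And>k. k \<in> L \<Longrightarrow> Y k \<subseteq> U' (\<sigma> k)"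
    and \<sigma>': "\<And>k. k \<in> L \<Longrightarrow> \<sigma>' k \<in> I''" "\<And>k. k \<in> L \<Longrightarrow> Y k \<subseteq> U'' (\<sigma>' k)"
    and \<nu>: "\<And>k. k \<in> L \<Longrightarrow> \<nu> k \<in> carrier (G (Y k))"
    and eq': "\<And>k m V. \<lbrakk>k \<in> L; m \<in> L; openin T V; V \<subseteq> Y k; V \<subseteq> Y m\<rbrakk> \<Longrightarrow>
      res V (g'' (\<sigma>' k) (\<sigma>' m)) \<otimes>\<^bsub>G V\<^esub> res V (\<nu> m) = res V (\<nu> k) \<otimes>\<^bsub>G V\<^esub> res V (g' (\<sigma> k) (\<sigma> m))"
    by (rule cohomologousE[OF assms(2)[unfolded zdef(2,3)]]) blast
  \<comment> \<open>A common refinement of \<open>W\<close> and \<open>Y\<close> would naturally be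
    indexed by \<open>K \<times> L\<close>, but covers are indexed by sets of points. So each point
    \<open>x\<close> chooses one member of either cover containing it, and \<open>N x\<close> is
    their intersection.\<close>
  have "\<forall>x\<in>topspace T. \<exists>k\<in>K. x \<in> W k" "\<forall>x\<in>topspace T. \<exists>p\<in>L. x \<in> Y p"
    using cK cL by (auto simp: open_cover_def)
  then obtain k p where k: "\<And>x. x \<in> topspace T \<Longrightarrow> k x \<in> K \<and> x \<in> W (k x)"
    and p: "\<And>x. x \<in> topspace T \<Longrightarrow> p x \<in> L \<and> x \<in> Y (p x)"
    by metis
  define N where "N x = W (k x) \<inter> Y (p x)" for x
  have N: "openin T (N x)" "N x \<subseteq> W (k x)" "N x \<subseteq> Y (p x)" "x \<in> N x" if "x \<in> topspace T" for x
    using that k[of x] p[of x] W Y by (auto simp: N_def)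
  have cN: "open_cover T (topspace T) N"
    using N openin_subset[OF N(1)] by (force simp: open_cover_def)
  \<comment> \<open>The two coboundaries are written with different indices of \<open>z'\<close>; the middle factor changes one
    into the other.\<close>
  define \<xi> where "\<xi> x = res (N x) (\<nu> (p x)) \<otimes>\<^bsub>G (N x)\<^esub>
    (res (N x) (g' (\<sigma> (p x)) (\<tau>' (k x))) \<otimes>\<^bsub>G (N x)\<^esub> res (N x) (\<mu> (k x)))" for x
  have cl: "res V (\<nu> (p x)) \<in> carrier (G V)" "res V (\<mu> (k x)) \<in> carrier (G V)"
      "res V (g' (\<sigma> (p x)) (\<tau>' (k y))) \<in> carrier (G V)"
      "res V (g' (\<sigma> (p x)) (\<sigma> (p y))) \<in> carrier (G V)"
      "res V (g' (\<tau>' (k x)) (\<tau>' (k y))) \<in> carrier (G V)"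
      "res V (g (\<tau> (k x)) (\<tau> (k y))) \<in> carrier (G V)"
      "res V (g'' (\<sigma>' (p x)) (\<sigma>' (p y))) \<in> carrier (G V)"
    if "x \<in> topspace T" "y \<in> topspace T" "openin T V" "V \<subseteq> N x" "V \<subseteq> N y" for x y V
  proof -
    have kp: "k x \<in> K" "k y \<in> K" "p x \<in> L" "p y \<in> L"
      using k p that by auto
    have V: "V \<subseteq> W (k x)" "V \<subseteq> W (k y)" "V \<subseteq> Y (p x)" "V \<subseteq> Y (p y)"
      using that by (auto simp: N_def)
    have V': "V \<subseteq> U (\<tau> (k x))" "V \<subseteq> U (\<tau> (k y))" "V \<subseteq> U' (\<tau>' (k x))" "V \<subseteq> U' (\<tau>' (k y))"
        "V \<subseteq> U' (\<sigma> (p x))" "V \<subseteq> U' (\<sigma> (p y))" "V \<subseteq> U'' (\<sigma>' (p x))" "V \<subseteq> U'' (\<sigma>' (p y))"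
      using V \<tau>(2)[OF kp(1)] \<tau>(2)[OF kp(2)] \<tau>'(2)[OF kp(1)] \<tau>'(2)[OF kp(2)]
        \<sigma>(2)[OF kp(3)] \<sigma>(2)[OF kp(4)] \<sigma>'(2)[OF kp(3)] \<sigma>'(2)[OF kp(4)] by auto
    show "res V (\<nu> (p x)) \<in> carrier (G V)" "res V (\<mu> (k x)) \<in> carrier (G V)"
      by (rule res_closed[OF Y[OF kp(3)] that(3) V(3) \<nu>[OF kp(3)]],
          rule res_closed[OF W[OF kp(1)] that(3) V(1) \<mu>[OF kp(1)]])
    show "res V (g' (\<sigma> (p x)) (\<tau>' (k y))) \<in> carrier (G V)"
      by (rule cocycle_closed[OF z(2) \<sigma>(1)[OF kp(3)] \<tau>'(1)[OF kp(2)] that(3) V'(5,4)])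
    show "res V (g' (\<sigma> (p x)) (\<sigma> (p y))) \<in> carrier (G V)"
      by (rule cocycle_closed[OF z(2) \<sigma>(1)[OF kp(3)] \<sigma>(1)[OF kp(4)] that(3) V'(5,6)])
    show "res V (g' (\<tau>' (k x)) (\<tau>' (k y))) \<in> carrier (G V)"
      by (rule cocycle_closed[OF z(2) \<tau>'(1)[OF kp(1)] \<tau>'(1)[OF kp(2)] that(3) V'(3,4)])
    show "res V (g (\<tau> (k x)) (\<tau> (k y))) \<in> carrier (G V)"
      by (rule cocycle_closed[OF z(1) \<tau>(1)[OF kp(1)] \<tau>(1)[OF kp(2)] that(3) V'(1,2)])
    show "res V (g'' (\<sigma>' (p x)) (\<sigma>' (p y))) \<in> carrier (G V)"
      by (rule cocycle_closed[OF z(3) \<sigma>'(1)[OF kp(3)] \<sigma>'(1)[OF kp(4)] that(3) V'(7,8)])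
  qed
  have \<xi>: "\<xi> x \<in> carrier (G (N x))" if x: "x \<in> topspace T" for x
  proof -
    note c = cl[OF x x N(1)[OF x] order_refl order_refl]
    interpret group "G (N x)"
      using group[OF N(1)[OF x] c(1)] .
    show ?thesis
      using c unfolding \<xi>_def by simp
  qed
  have \<xi>_res: "res V (\<xi> x) = res V (\<nu> (p x)) \<otimes>\<^bsub>G V\<^esub>
      (res V (g' (\<sigma> (p x)) (\<tau>' (k x))) \<otimes>\<^bsub>G V\<^esub> res V (\<mu> (k x)))"
    if x: "x \<in> topspace T" and V: "openin T V" "V \<subseteq> N x" for x V
  proof -
    note c = cl[OF x x N(1)[OF x] order_refl order_refl]
    interpret group "G (N x)"
      using group[OF N(1)[OF x] c(1)] .
    show ?thesis
      using c V N(1)[OF x] unfolding \<xi>_def by (simp add: res_mult res_res)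
  qed
  have "res V (g'' (\<sigma>' (p x)) (\<sigma>' (p y))) \<otimes>\<^bsub>G V\<^esub> res V (\<xi> y) =
      res V (\<xi> x) \<otimes>\<^bsub>G V\<^esub> res V (g (\<tau> (k x)) (\<tau> (k y)))"
    if x: "x \<in> topspace T" and y: "y \<in> topspace T" and V_def: "V = N x \<inter> N y" for x y V
  proof -
    have V: "openin T V" "V \<subseteq> N x" "V \<subseteq> N y"
      using N x y V_def by auto
    note c = cl[OF x y V] cl[OF y x V(1,3,2)] cl[OF y y V(1,3,3)] cl[OF x x V(1,2,2)]
    interpret group "G V"
      using group[OF V(1) c(1)] .
    have kp: "k x \<in> K" "k y \<in> K" "p x \<in> L" "p y \<in> L"
      using k p x y by auto
    have VN: "V \<subseteq> W (k x)" "V \<subseteq> W (k y)" "V \<subseteq> Y (p x)" "V \<subseteq> Y (p y)"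
      using V by (auto simp: N_def)
    have VU: "V \<subseteq> U' (\<tau>' (k x))" "V \<subseteq> U' (\<tau>' (k y))" "V \<subseteq> U' (\<sigma> (p x))" "V \<subseteq> U' (\<sigma> (p y))"
      using VN \<tau>'(2)[OF kp(1)] \<tau>'(2)[OF kp(2)] \<sigma>(2)[OF kp(3)] \<sigma>(2)[OF kp(4)] by auto
    let ?r = "res V"
    let ?a = "?r (g'' (\<sigma>' (p x)) (\<sigma>' (p y)))" and ?b = "?r (g (\<tau> (k x)) (\<tau> (k y)))"
    let ?\<nu> = "\<lambda>x. ?r (\<nu> (p x))" and ?\<mu> = "\<lambda>x. ?r (\<mu> (k x))"
    let ?h = "\<lambda>x y. ?r (g' (\<sigma> (p x)) (\<tau>' (k y)))"
    have "?a \<otimes>\<^bsub>G V\<^esub> ?r (\<xi> y) = (?a \<otimes>\<^bsub>G V\<^esub> ?\<nu> y) \<otimes>\<^bsub>G V\<^esub> (?h y y \<otimes>\<^bsub>G V\<^esub> ?\<mu> y)"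
      using c \<xi>_res[OF y V(1,3)] by (simp add: m_assoc)
    also have "?a \<otimes>\<^bsub>G V\<^esub> ?\<nu> y = ?\<nu> x \<otimes>\<^bsub>G V\<^esub> ?r (g' (\<sigma> (p x)) (\<sigma> (p y)))"
      by (rule eq'[OF kp(3,4) V(1) VN(3,4)])
    also have "\<dots> \<otimes>\<^bsub>G V\<^esub> (?h y y \<otimes>\<^bsub>G V\<^esub> ?\<mu> y) =
        ?\<nu> x \<otimes>\<^bsub>G V\<^esub> ((?r (g' (\<sigma> (p x)) (\<sigma> (p y))) \<otimes>\<^bsub>G V\<^esub> ?h y y) \<otimes>\<^bsub>G V\<^esub> ?\<mu> y)"
      using c by (simp add: m_assoc)
    \<comment> \<open>Here and in the next step the cocycle identity of \<open>g'\<close> computes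
      \<open>?h x y\<close> in two ways: passing from \<open>x\<close> to \<open>y\<close> among the
      indices \<open>\<sigma>\<close> and then changing to \<open>\<tau>'\<close>, or changing to
      \<open>\<tau>'\<close> at \<open>x\<close> first.\<close>
    also have "?r (g' (\<sigma> (p x)) (\<sigma> (p y))) \<otimes>\<^bsub>G V\<^esub> ?h y y = ?h x y"
      by (rule cocycle_mult[OF z(2) \<sigma>(1)[OF kp(3)] \<sigma>(1)[OF kp(4)] \<tau>'(1)[OF kp(2)] V(1) VU(3,4,2)])
    also have "\<dots> = ?h x x \<otimes>\<^bsub>G V\<^esub> ?r (g' (\<tau>' (k x)) (\<tau>' (k y)))"
      by (rule cocycle_mult[OF z(2) \<sigma>(1)[OF kp(3)] \<tau>'(1)[OF kp(1)] \<tau>'(1)[OF kp(2)] V(1) VU(3,1,2),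
            symmetric])
    also have "?\<nu> x \<otimes>\<^bsub>G V\<^esub> (\<dots> \<otimes>\<^bsub>G V\<^esub> ?\<mu> y) =
        ?\<nu> x \<otimes>\<^bsub>G V\<^esub> (?h x x \<otimes>\<^bsub>G V\<^esub> (?r (g' (\<tau>' (k x)) (\<tau>' (k y))) \<otimes>\<^bsub>G V\<^esub> ?\<mu> y))"
      using c by (simp add: m_assoc)
    also have "?r (g' (\<tau>' (k x)) (\<tau>' (k y))) \<otimes>\<^bsub>G V\<^esub> ?\<mu> y = ?\<mu> x \<otimes>\<^bsub>G V\<^esub> ?b"
      by (rule eq[OF kp(1,2) V(1) VN(1,2)])
    also have "?\<nu> x \<otimes>\<^bsub>G V\<^esub> (?h x x \<otimes>\<^bsub>G V\<^esub> (?\<mu> x \<otimes>\<^bsub>G V\<^esub> ?b)) = ?r (\<xi> x) \<otimes>\<^bsub>G V\<^esub> ?b"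
      using c \<xi>_res[OF x V(1,2)] by (simp add: m_assoc)
    finally show ?thesis .
  qed
  moreover have "\<tau> (k x) \<in> I \<and> N x \<subseteq> U (\<tau> (k x)) \<and> \<sigma>' (p x) \<in> I'' \<and> N x \<subseteq> U'' (\<sigma>' (p x))"
    if "x \<in> topspace T" for x
    using k[OF that] p[OF that] \<tau> \<sigma>' N[OF that] by (meson subset_trans)
  ultimately show ?thesis
    unfolding zdef
    by (intro cohomologousI[OF z(1,3) cN, of "\<lambda>x. \<tau> (k x)" "\<lambda>x. \<sigma>' (p x)" \<xi>]) (use \<xi> in simp_all)
qed

end

section \<open>Enlarging the presheaf of groups\<close>

lemma cocycles_mono:
  assumes "\<And>U. carrier (G U) \<subseteq> carrier (H U)" "\<And>U. mult (G U) = mult (H U)"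
  shows "cocycles T G res \<subseteq> cocycles T H res"
  using assms(1) unfolding cocycles_def assms(2) by (auto simp: Let_def)

text \<open>The relation is phrased with carriers and products alone, free of units and inverses, so
  comparing these two is enough. It is applied to the inclusion of a higher level in a lower one and
  to that of the relative sheaf in the full sheaf.\<close>

lemma cohomologous_mono:
  assumes "\<And>U. carrier (G U) \<subseteq> carrier (H U)" "\<And>U. mult (G U) = mult (H U)"
  shows "cohomologous T G res \<subseteq> cohomologous T H res"
proof -
  have "cocycles T G res \<subseteq> cocycles T H res"
    using assms by (rule cocycles_mono)
  then show ?thesis
    using assms(1) unfolding cohomologous_def assms(2) by (clarsimp; blast)
qed

section \<open>The groups of automorphisms\<close>

text \<open>A common form for all the structure an automorphism respects: \<open>op\<close> is
  binary on pairs of sections, nullary on \<open>unit\<close>, a scaling, or a restriction between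
  two open sets. Closure under identity, composition and inversion is then proved once. Only
  \<open>g\<close> is required to be extensional; \<open>f\<close> may be a
  \<open>map_prod\<close>.\<close>

definition intertwines ::
  "('a \<Rightarrow> 'b) \<Rightarrow> 'a set \<Rightarrow> 'b set \<Rightarrow> ('a \<Rightarrow> 'a) \<Rightarrow> ('b \<Rightarrow> 'b) \<Rightarrow> bool" where
  "intertwines op A B f g \<longleftrightarrow> bij_betw f A A \<and> g \<in> Bij B \<and> (\<forall>x\<in>A. g (op x) = op (f x))"

text \<open>
  It is not assumed that \<open>op\<close> maps \<open>A\<close> to \<open>B\<close>.  The extensional bijection \<open>g\<close> sends every point
  outside \<open>B\<close> to \<open>undefined\<close>; as \<open>f\<close> is onto, \<open>op\<close> can leave \<open>B\<close> only by the value \<open>undefined\<close>, and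
  then identities, composites and inverses intertwine \<open>op\<close> as well.
\<close>

lemma intertwines_range:
  assumes "intertwines op A B f g" "x \<in> A"
  shows "op x \<in> B \<or> op x = undefined"
proof -
  obtain t where t: "t \<in> A" "x = f t"
    using assms by (auto simp: intertwines_def bij_betw_def)
  then have "op x = g (op t)"
    using assms by (simp add: intertwines_def)
  then show ?thesis
    using assms by (cases "op t \<in> B") (auto simp: intertwines_def Bij_def extensional_def bij_betw_def)
qed

text \<open>The given pair \<open>f\<close>, \<open>g\<close> enters through
  \<open>intertwines_range\<close>: outside \<open>B\<close> the value of \<open>op\<close> is
  \<open>undefined\<close>, which is also what the restricted identity returns there.\<close>

lemma intertwines_id:
  assumes "intertwines op A B f g" "\<And>x. x \<in> A \<Longrightarrow> h x = x"
  shows "intertwines op A B h (\<lambda>x\<in>B. x)"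
proof -
  have "bij_betw h A A"
    using bij_betw_cong[of A h "\<lambda>x. x" A] assms(2) by (simp add: bij_betw_def)
  moreover have "(\<lambda>x\<in>B. x) (op x) = op (h x)" if "x \<in> A" for x
    using intertwines_range[OF assms(1) that] assms(2)[OF that] by auto
  ultimately show ?thesis
    by (simp add: intertwines_def id_Bij)
qed

lemma intertwines_compose:
  assumes "intertwines op A B f g" "intertwines op A B f' g'" "\<And>x. x \<in> A \<Longrightarrow> h x = f (f' x)"
  shows "intertwines op A B h (compose B g g')"
proof -
  have f': "f' x \<in> A" if "x \<in> A" for x
    using assms(2) that by (auto simp: intertwines_def bij_betw_def)
  have "bij_betw h A A"
    using assms bij_betw_trans[of f' A A f A] bij_betw_cong[of A h "f \<circ> f'" A]
    by (simp add: intertwines_def)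
  moreover have "compose B g g' (op x) = op (h x)" if x: "x \<in> A" for x
  proof (cases "op x \<in> B")
    case True
    then show ?thesis
      using assms f'[OF x] x by (simp add: intertwines_def compose_eq)
  next
    \<comment> \<open>Here \<open>undefined\<close> lies outside \<open>B\<close>, so
      \<open>g\<close> and \<open>g'\<close> both fix it. Following it along \<open>f'\<close> and
      then \<open>f\<close> shows that \<open>op (h x)\<close> is \<open>undefined\<close> as
      well.\<close>
    case False
    then have u: "op x = undefined" "undefined \<notin> B"
      using intertwines_range[OF assms(1) x] by auto
    then have "g' undefined = undefined" "g undefined = undefined"
      using assms by (auto simp: intertwines_def Bij_def extensional_def)
    moreover have "g' (op x) = op (f' x)" "g (op (f' x)) = op (f (f' x))"
      using assms f'[OF x] x by (auto simp: intertwines_def)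
    ultimately show ?thesis
      using u assms(3)[OF x] by (simp add: compose_def)
  qed
  ultimately show ?thesis
    using assms by (simp add: intertwines_def compose_Bij)
qed

lemma intertwines_inv:
  assumes "intertwines op A B f g" "bij_betw h A A" "\<And>x. x \<in> A \<Longrightarrow> f (h x) = x"
  shows "intertwines op A B h (\<lambda>x\<in>B. inv_into B g x)"
proof -
  have "(\<lambda>x\<in>B. inv_into B g x) (op x) = op (h x)" if x: "x \<in> A" for x
  proof -
    have hx: "h x \<in> A"
      using assms(2) x by (auto simp: bij_betw_def)
    have eq: "op x = g (op (h x))"
      using assms hx x by (auto simp: intertwines_def)
    show ?thesis
    proof (cases "op (h x) \<in> B")
      case True
      then show ?thesis
        using assms(1) eq by (auto simp: intertwines_def Bij_def bij_betw_def)
    next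
      case False
      then have "op (h x) = undefined" "undefined \<notin> B"
        using intertwines_range[OF assms(1) hx] by auto
      moreover from this have "g undefined = undefined"
        using assms by (auto simp: intertwines_def Bij_def extensional_def)
      ultimately show ?thesis
        using eq by simp
    qed
  qed
  then show ?thesis
    using assms by (simp add: intertwines_def restrict_inv_into_Bij)
qed

text \<open>The conditions of \<open>aut_carrier\<close> that concern a single open set, with those
  on algebra operations expressed by \<open>intertwines\<close>. Compatibility with restriction
  relates two open sets and stays outside. The unit is treated as an operation on the one-element
  type.\<close>

definition section_aut ::
  "('a, 'e) model \<Rightarrow> enat \<Rightarrow> 'a set \<Rightarrow> (('a, 'e) ext_section \<Rightarrow> ('a, 'e) ext_section) \<Rightarrow> bool" where
  "section_aut M j V f \<longleftrightarrow> (let E = ext_sections M V in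
     f \<in> Bij E \<and>
     intertwines (\<lambda>(s, t). s \<otimes>\<^bsub>ext_alg M V\<^esub> t) (E \<times> E) E (map_prod f f) f \<and>
     intertwines (\<lambda>(s, t). s \<oplus>\<^bsub>ext_alg M V\<^esub> t) (E \<times> E) E (map_prod f f) f \<and>
     intertwines (\<lambda>_ :: unit. \<one>\<^bsub>ext_alg M V\<^esub>) UNIV E id f \<and>
     (\<forall>c. intertwines (ext_scale V c) E E f f) \<and>
     (\<forall>s\<in>E. (ext_even V s \<longrightarrow> ext_even V (f s)) \<and> (ext_odd V s \<longrightarrow> ext_odd V (f s)) \<and>
        (\<forall>y\<in>V. \<forall>l. enat (length l) < j \<longrightarrow> f s y l = s y l)))"

lemma bij_betw_map_prod_self:
  assumes "bij_betw f A A"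
  shows "bij_betw (map_prod f f) (A \<times> A) (A \<times> A)"
  using assms unfolding bij_betw_def by (simp add: map_prod_inj_on map_prod_surj_on)

text \<open>\<open>ring_iso\<close> asks for a bijection that preserves sum, product and one,
  without asking that its source be a ring. Together with extensionality this is exactly what the
  \<open>intertwines\<close> conditions say.\<close>

lemma aut_carrier_iff:
  "\<alpha> \<in> aut_carrier M j U \<longleftrightarrow> \<alpha> \<in> extensional (opens_in M U) \<and>
     (\<forall>V\<in>opens_in M U. section_aut M j V (\<alpha> V) \<and>
        (\<forall>V'\<in>opens_in M V. intertwines (\<lambda>s. restrict s V') (ext_sections M V) (ext_sections M V')
           (\<alpha> V) (\<alpha> V')))" (is "?L \<longleftrightarrow> ?R")
proof
  assume L: ?L
  have B: "\<alpha> V \<in> Bij (ext_sections M V)" if "V \<in> opens_in M U" for V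
    using L that unfolding aut_carrier_def Bij_def ring_iso_def by (simp add: ext_alg_def)
  have "section_aut M j V (\<alpha> V)" if V: "V \<in> opens_in M U" for V
  proof -
    have bij: "bij_betw (\<alpha> V) (ext_sections M V) (ext_sections M V)"
      using B[OF V] by (simp add: Bij_def)
    have "\<alpha> V \<in> ring_hom (ext_alg M V) (ext_alg M V)"
      using L V unfolding aut_carrier_def ring_iso_def by simp
    then show ?thesis
      using L V B[OF V] bij bij_betw_map_prod_self[OF bij]
      unfolding aut_carrier_def section_aut_def intertwines_def Let_def ring_hom_def
      by (simp add: ext_alg_def)
  qed
  moreover have "intertwines (\<lambda>s. restrict s V') (ext_sections M V) (ext_sections M V') (\<alpha> V) (\<alpha> V')"
    if V: "V \<in> opens_in M U" and V': "V' \<in> opens_in M V" for V V'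
  proof -
    have "V' \<in> opens_in M U"
      using V V' by auto
    then show ?thesis
      using L V V' B[OF V] B[of V'] unfolding aut_carrier_def intertwines_def
      by (simp add: Bij_def)
  qed
  ultimately show ?R
    using L by (simp add: aut_carrier_def)
next
  assume R: ?R
  have "\<alpha> V \<in> extensional (ext_sections M V) \<and> \<alpha> V \<in> ring_iso (ext_alg M V) (ext_alg M V) \<and>
       (\<forall>s\<in>ext_sections M V.
          (\<forall>c. \<alpha> V (ext_scale V c s) = ext_scale V c (\<alpha> V s)) \<and>
          (ext_even V s \<longrightarrow> ext_even V (\<alpha> V s)) \<and>
          (ext_odd V s \<longrightarrow> ext_odd V (\<alpha> V s)) \<and>
          (\<forall>V'\<in>opens_in M V. \<alpha> V' (restrict s V') = restrict (\<alpha> V s) V') \<and>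
          (\<forall>y\<in>V. \<forall>l. enat (length l) < j \<longrightarrow> \<alpha> V s y l = s y l))"
    if V: "V \<in> opens_in M U" for V
  proof -
    have s: "section_aut M j V (\<alpha> V)"
      using R V by blast
    have r: "\<forall>V'\<in>opens_in M V. \<forall>s\<in>ext_sections M V. \<alpha> V' (restrict s V') = restrict (\<alpha> V s) V'"
      using R V unfolding intertwines_def by blast
    have bij: "bij_betw (\<alpha> V) (ext_sections M V) (ext_sections M V)"
      using s by (simp add: section_aut_def Let_def Bij_def)
    have "\<alpha> V \<in> ring_iso (ext_alg M V) (ext_alg M V)"
      using s bij unfolding section_aut_def intertwines_def Let_def ring_iso_def ring_hom_def
      by (auto simp: ext_alg_def bij_betw_def)
    moreover have "\<alpha> V \<in> extensional (ext_sections M V)"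
      using s by (simp add: section_aut_def Let_def Bij_def)
    ultimately show ?thesis
      using s r unfolding section_aut_def intertwines_def Let_def by blast
  qed
  with R show ?L
    unfolding aut_carrier_def mem_Collect_eq by simp
qed

lemma section_autD:
  assumes "section_aut M j V f"
  shows section_aut_Bij: "f \<in> Bij (ext_sections M V)"
    and section_aut_mult: "intertwines (\<lambda>(s, t). s \<otimes>\<^bsub>ext_alg M V\<^esub> t)
      (ext_sections M V \<times> ext_sections M V) (ext_sections M V) (map_prod f f) f"
    and section_aut_add: "intertwines (\<lambda>(s, t). s \<oplus>\<^bsub>ext_alg M V\<^esub> t)
      (ext_sections M V \<times> ext_sections M V) (ext_sections M V) (map_prod f f) f"
    and section_aut_one: "intertwines (\<lambda>_ :: unit. \<one>\<^bsub>ext_alg M V\<^esub>) UNIV (ext_sections M V) id f"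
    and section_aut_scale: "intertwines (ext_scale V c) (ext_sections M V) (ext_sections M V) f f"
    and section_aut_even: "\<lbrakk>s \<in> ext_sections M V; ext_even V s\<rbrakk> \<Longrightarrow> ext_even V (f s)"
    and section_aut_odd: "\<lbrakk>s \<in> ext_sections M V; ext_odd V s\<rbrakk> \<Longrightarrow> ext_odd V (f s)"
    and section_aut_degree:
      "\<lbrakk>s \<in> ext_sections M V; y \<in> V; enat (length l) < j\<rbrakk> \<Longrightarrow> f s y l = s y l"
  using assms by (simp_all add: section_aut_def Let_def)

lemma section_aut_closed:
  assumes "section_aut M j V f" "s \<in> ext_sections M V"
  shows "f s \<in> ext_sections M V"
  using section_aut_Bij[OF assms(1)] assms(2) by (auto simp: Bij_def bij_betw_def)

lemma section_autI:
  assumes "f \<in> Bij (ext_sections M V)"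
    and "intertwines (\<lambda>(s, t). s \<otimes>\<^bsub>ext_alg M V\<^esub> t)
      (ext_sections M V \<times> ext_sections M V) (ext_sections M V) (map_prod f f) f"
    and "intertwines (\<lambda>(s, t). s \<oplus>\<^bsub>ext_alg M V\<^esub> t)
      (ext_sections M V \<times> ext_sections M V) (ext_sections M V) (map_prod f f) f"
    and "intertwines (\<lambda>_ :: unit. \<one>\<^bsub>ext_alg M V\<^esub>) UNIV (ext_sections M V) id f"
    and "\<And>c. intertwines (ext_scale V c) (ext_sections M V) (ext_sections M V) f f"
    and "\<And>s. \<lbrakk>s \<in> ext_sections M V; ext_even V s\<rbrakk> \<Longrightarrow> ext_even V (f s)"
    and "\<And>s. \<lbrakk>s \<in> ext_sections M V; ext_odd V s\<rbrakk> \<Longrightarrow> ext_odd V (f s)"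
    and "\<And>s y l. \<lbrakk>s \<in> ext_sections M V; y \<in> V; enat (length l) < j\<rbrakk> \<Longrightarrow> f s y l = s y l"
  shows "section_aut M j V f"
  using assms by (simp add: section_aut_def Let_def)

lemma section_aut_id:
  assumes "section_aut M j V f"
  shows "section_aut M j V (\<lambda>s\<in>ext_sections M V. s)"
  by (rule section_autI)
    (auto simp: id_Bij intro: intertwines_id[OF section_aut_mult[OF assms]]
      intertwines_id[OF section_aut_add[OF assms]] intertwines_id[OF section_aut_one[OF assms]]
      intertwines_id[OF section_aut_scale[OF assms]])

lemma section_aut_compose:
  assumes f: "section_aut M j V f" and g: "section_aut M j V g"
  shows "section_aut M j V (compose (ext_sections M V) f g)"
  by (rule section_autI)
    (auto simp: compose_Bij compose_eq section_aut_Bij[OF f] section_aut_Bij[OF g]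
      section_aut_closed[OF g] section_aut_even[OF f] section_aut_even[OF g]
      section_aut_odd[OF f] section_aut_odd[OF g] section_aut_degree[OF f] section_aut_degree[OF g]
      intro: intertwines_compose[OF section_aut_mult[OF f] section_aut_mult[OF g]]
      intertwines_compose[OF section_aut_add[OF f] section_aut_add[OF g]]
      intertwines_compose[OF section_aut_one[OF f] section_aut_one[OF g]]
      intertwines_compose[OF section_aut_scale[OF f] section_aut_scale[OF g]])

text \<open>
  Values outside \<open>V\<close> do not matter because the image of \<open>V\<close> in a chart is open.
\<close>

lemma hol_fun_cong:
  assumes M: "complex_manifold M" and V: "openin (mtop M) V"
    and f: "hol_fun M V f" and eq: "\<And>y. y \<in> V \<Longrightarrow> g y = f y"
  shows "hol_fun M V g"
  unfolding hol_fun_def holomorphic_n_def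
proof clarify
  fix C \<phi> z y
  assume C: "(C, \<phi>) \<in> atlas M" and y: "y \<in> V" "y \<in> C"
  have chart: "openin (mtop M) C" "openin (top_of_set (cspace (mdim M))) (\<phi> ` C)"
      "homeomorphic_map (subtopology (mtop M) C) (top_of_set (\<phi> ` C)) \<phi>"
    using M C by (auto simp: complex_manifold_def top_chart_def)
  have inj: "inj_on \<phi> C"
    using homeomorphic_imp_injective_map[OF chart(3)] openin_subset[OF chart(1)]
    by (simp add: Int_absorb1)
  have "openin (subtopology (mtop M) C) (V \<inter> C)"
    using V by (auto simp: openin_subtopology)
  then have "openin (top_of_set (\<phi> ` C)) (\<phi> ` (V \<inter> C))"
    using homeomorphic_map_openness_eq[OF chart(3)] by blast
  then have "openin (top_of_set (cspace (mdim M))) (\<phi> ` (V \<inter> C))"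
    using chart(2) openin_trans by blast
  then obtain S where S: "open S" "\<phi> ` (V \<inter> C) = cspace (mdim M) \<inter> S"
    by (auto simp: openin_open)
  have z: "\<phi> y \<in> S"
    using S(2) y by blast
  have eq': "g (inv_into C \<phi> w) = f (inv_into C \<phi> w)" if w: "w \<in> S" "w \<in> cspace (mdim M)" for w
  proof -
    obtain x where x: "w = \<phi> x" "x \<in> V" "x \<in> C"
      using S(2) w by blast
    then show ?thesis
      using eq inj by simp
  qed
  obtain a where "has_cgradient (mdim M) (\<lambda>z. f (inv_into C \<phi> z)) a (\<phi> y)"
    using f C y unfolding hol_fun_def holomorphic_n_def by blast
  \<comment> \<open>The value at the centre enters every difference quotient, so agreement near the
    centre has to include the centre itself.\<close>
  moreover have "g (inv_into C \<phi> (\<phi> y)) = f (inv_into C \<phi> (\<phi> y))"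
    using eq inj y by simp
  ultimately have "has_cgradient (mdim M) (\<lambda>z. g (inv_into C \<phi> z)) a (\<phi> y)"
    unfolding has_cgradient_def
    by (rule_tac Lim_transform_eventually)
      (auto simp: eventually_at_topological eq' intro!: exI[of _ S] S(1) z)
  then show "\<exists>a. has_cgradient (mdim M) (\<lambda>z. g (inv_into C \<phi> z)) a (\<phi> y)"
    by blast
qed

lemma hol_fun_zero: "hol_fun M V (\<lambda>y. 0)"
  unfolding hol_fun_def holomorphic_n_def has_cgradient_def by (auto intro!: exI[of _ "\<lambda>i. 0"])

section \<open>Even and odd parts of sections, and inverses of automorphisms\<close>

definition parity_part :: "'a set \<Rightarrow> bool \<Rightarrow> ('a, 'e) ext_section \<Rightarrow> ('a, 'e) ext_section" where
  "parity_part V b s = (\<lambda>y\<in>V. \<lambda>l. if even (length l) = b then s y l else 0)"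

text \<open>The linearity conditions of \<open>forms\<close> compare lists of equal length, so they
  survive deleting all degrees of one parity. Each frame coefficient becomes that of
  \<open>s\<close> or zero on \<open>V\<close>; \<open>hol_fun_cong\<close> absorbs the values
  outside \<open>V\<close>.\<close>

lemma parity_part_section:
  assumes M: "is_model M" and V: "openin (mtop M) V" and s: "s \<in> ext_sections M V"
  shows "parity_part V b s \<in> ext_sections M V"
proof -
  have "(\<lambda>l. if even (length l) = b then \<omega> l else 0) \<in> forms F" if "\<omega> \<in> forms F" for \<omega> and F :: "(complex, 'b) module"
    using that unfolding forms_def by auto
  moreover have "hol_fun M (V \<inter> W) (\<lambda>y. parity_part V b s y (map (\<lambda>i. coframe (odd_bundle M) e i y) is))"
    if W: "(W, e) \<in> frames (odd_bundle M)" and "is": "set is \<subseteq> {..<vrank (odd_bundle M)}" for W e "is"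
  proof -
    have cm: "complex_manifold M" and oW: "openin (mtop M) (V \<inter> W)"
      using M W V by (auto simp: is_model_def holomorphic_vbundle_def)
    show ?thesis
    proof (cases "even (length is) = b")
      case True
      have "hol_fun M (V \<inter> W) (\<lambda>y. s y (map (\<lambda>i. coframe (odd_bundle M) e i y) is))"
        using s W "is" unfolding ext_sections_def by blast
      then show ?thesis
        by (rule hol_fun_cong[OF cm oW]) (use True in \<open>simp add: parity_part_def\<close>)
    next
      case False
      show ?thesis
        by (rule hol_fun_cong[OF cm oW hol_fun_zero]) (use False in \<open>simp add: parity_part_def\<close>)
    qed
  qed
  ultimately show ?thesis
    using s unfolding ext_sections_def by (auto simp: parity_part_def)
qed

text \<open>Split \<open>t\<close> into its part of parity \<open>b\<close> and the other part.
  Their images under \<open>f\<close> keep these parities and add up to \<open>f t\<close>, which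
  has parity \<open>b\<close>; so the image of the other part vanishes, and injectivity makes that
  part zero.\<close>

lemma section_aut_reflects_parity:
  assumes M: "is_model M" and V: "openin (mtop M) V" and f: "section_aut M j V f"
    and t: "t \<in> ext_sections M V"
    and par: "\<And>y l. \<lbrakk>y \<in> V; even (length l) \<noteq> b\<rbrakk> \<Longrightarrow> f t y l = 0"
    and y: "y \<in> V" and l: "even (length l) \<noteq> b"
  shows "t y l = 0"
proof -
  let ?E = "ext_sections M V" and ?p = "parity_part V"
  have p: "?p c t \<in> ?E" for c
    using parity_part_section[OF M V t] .
  have f_par: "f (?p c t) y l = 0" if "y \<in> V" "even (length l) \<noteq> c" for c y l
    using section_aut_even[OF f p[of True]] section_aut_odd[OF f p[of False]] that
    by (cases c) (auto simp: ext_even_def ext_odd_def parity_part_def)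
  have "?p b t \<oplus>\<^bsub>ext_alg M V\<^esub> ?p (\<not> b) t = t"
    using t by (auto simp: ext_alg_def parity_part_def ext_sections_def extensional_def fun_eq_iff)
  then have "f t = f (?p b t) \<oplus>\<^bsub>ext_alg M V\<^esub> f (?p (\<not> b) t)"
    using section_aut_add[OF f] p[of b] p[of "\<not> b"] unfolding intertwines_def by fastforce
  then have "f (?p (\<not> b) t) y l = 0" if "y \<in> V" for y l
    using par[OF that, of l] f_par[OF that, of l b] f_par[OF that, of l "\<not> b"] that
    by (cases "even (length l) = b") (auto simp: ext_alg_def)
  then have "f (?p (\<not> b) t) = (\<lambda>y\<in>V. \<lambda>l. 0)"
    using section_aut_closed[OF f p[of "\<not> b"]]
    by (auto simp: ext_sections_def extensional_def fun_eq_iff)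
  \<comment> \<open>The conditions on \<open>f\<close> do not mention zero; that \<open>f\<close>
    fixes the zero section comes from compatibility with the scalar 0.\<close>
  moreover have z: "(\<lambda>y\<in>V. \<lambda>l. 0) = ext_scale V 0 (?p (\<not> b) t)"
    by (auto simp: ext_scale_def)
  moreover have "f (ext_scale V 0 (?p (\<not> b) t)) = ext_scale V 0 (f (?p (\<not> b) t))"
    using section_aut_scale[OF f] p unfolding intertwines_def by blast
  moreover have "ext_scale V 0 (f (?p (\<not> b) t)) = (\<lambda>y\<in>V. \<lambda>l. 0)"
    by (auto simp: ext_scale_def)
  ultimately have "f (?p (\<not> b) t) = f (\<lambda>y\<in>V. \<lambda>l. 0)"
    by simp
  \<comment> \<open>Injectivity can be applied only within the sections. The zero section is one of
    them, being the part of one parity of a section of the other parity.\<close>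
  moreover have "(\<lambda>y\<in>V. \<lambda>l. 0) \<in> ?E"
  proof -
    have "?p (\<not> b) (?p b t) = (\<lambda>y\<in>V. \<lambda>l. 0)"
      by (auto simp: parity_part_def fun_eq_iff)
    then show ?thesis
      using parity_part_section[OF M V p] by metis
  qed
  moreover have "inj_on f ?E"
    using section_aut_Bij[OF f] by (simp add: Bij_def bij_betw_def)
  ultimately have "?p (\<not> b) t = (\<lambda>y\<in>V. \<lambda>l. 0)"
    using p by (blast dest: inj_onD)
  then have "?p (\<not> b) t y l = 0"
    using y by simp
  then show ?thesis
    using y l by (auto simp: parity_part_def split: if_splits)
qed

text \<open>The algebra conditions follow from \<open>intertwines_inv\<close>, parity from
  \<open>section_aut_reflects_parity\<close>. In degrees below \<open>j\<close>, \<open>f\<close>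
  does not change the preimage of \<open>s\<close>, which therefore agrees there with
  \<open>s\<close>.\<close>

lemma section_aut_inv:
  assumes M: "is_model M" and V: "openin (mtop M) V" and f: "section_aut M j V f"
  shows "section_aut M j V (\<lambda>s\<in>ext_sections M V. inv_into (ext_sections M V) f s)"
proof -
  let ?E = "ext_sections M V"
  let ?h = "\<lambda>s\<in>?E. inv_into ?E f s"
  have bij: "bij_betw f ?E ?E"
    using section_aut_Bij[OF f] by (simp add: Bij_def)
  have hB: "?h \<in> Bij ?E"
    using section_aut_Bij[OF f] by (rule restrict_inv_into_Bij)
  then have h: "bij_betw ?h ?E ?E"
    by (simp add: Bij_def)
  have fh: "f (?h s) = s" if "s \<in> ?E" for s
    using that bij by (simp add: bij_betw_inv_into_right)
  have hE: "?h s \<in> ?E" if "s \<in> ?E" for s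
    using that h by (auto simp: bij_betw_def)
  have inv2: "map_prod f f (map_prod ?h ?h x) = x" if "x \<in> ?E \<times> ?E" for x
    using that fh by auto
  show ?thesis
  proof (rule section_autI)
    show "?h \<in> Bij ?E"
      by fact
    show "intertwines (\<lambda>(s, t). s \<otimes>\<^bsub>ext_alg M V\<^esub> t) (?E \<times> ?E) ?E (map_prod ?h ?h) ?h"
      by (rule intertwines_inv[OF section_aut_mult[OF f] bij_betw_map_prod_self[OF h] inv2])
    show "intertwines (\<lambda>(s, t). s \<oplus>\<^bsub>ext_alg M V\<^esub> t) (?E \<times> ?E) ?E (map_prod ?h ?h) ?h"
      by (rule intertwines_inv[OF section_aut_add[OF f] bij_betw_map_prod_self[OF h] inv2])
    show "intertwines (\<lambda>_ :: unit. \<one>\<^bsub>ext_alg M V\<^esub>) UNIV ?E id ?h"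
      by (rule intertwines_inv[OF section_aut_one[OF f]]) auto
    show "intertwines (ext_scale V c) ?E ?E ?h ?h" for c
      by (rule intertwines_inv[OF section_aut_scale[OF f] h fh])
  next
    fix s assume s: "s \<in> ?E" "ext_even V s"
    then show "ext_even V (?h s)"
      using section_aut_reflects_parity[OF M V f hE[OF s(1)], of True] fh[OF s(1)]
      unfolding ext_even_def by auto
  next
    fix s assume s: "s \<in> ?E" "ext_odd V s"
    then show "ext_odd V (?h s)"
      using section_aut_reflects_parity[OF M V f hE[OF s(1)], of False] fh[OF s(1)]
      unfolding ext_odd_def by auto
  next
    show "?h s y l = s y l" if s: "s \<in> ?E" "y \<in> V" "enat (length l) < j" for s y l
      using s section_aut_degree[OF f hE[OF s(1)], of y l] fh[OF s(1)] by simp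
  qed
qed

section \<open>The presheaf of automorphism groups\<close>

lemma aut_carrier_section_aut:
  "\<lbrakk>\<alpha> \<in> aut_carrier M j U; V \<in> opens_in M U\<rbrakk> \<Longrightarrow> section_aut M j V (\<alpha> V)"
  unfolding aut_carrier_iff by blast

lemma aut_carrier_intertwines_restrict:
  "\<lbrakk>\<alpha> \<in> aut_carrier M j U; V \<in> opens_in M U; V' \<in> opens_in M V\<rbrakk> \<Longrightarrow>
    intertwines (\<lambda>s. restrict s V') (ext_sections M V) (ext_sections M V') (\<alpha> V) (\<alpha> V')"
  unfolding aut_carrier_iff by blast

lemma aut_carrier_one:
  assumes "\<alpha> \<in> aut_carrier M j U"
  shows "(\<lambda>V\<in>opens_in M U. \<lambda>s\<in>ext_sections M V. s) \<in> aut_carrier M j U"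
proof -
  have "intertwines (\<lambda>s. restrict s V') (ext_sections M V) (ext_sections M V')
      (\<lambda>s\<in>ext_sections M V. s) (\<lambda>s\<in>ext_sections M V'. s)"
    if "V \<in> opens_in M U" "V' \<in> opens_in M V" for V V'
    by (rule intertwines_id[OF aut_carrier_intertwines_restrict[OF assms that]]) simp
  then show ?thesis
    using assms unfolding aut_carrier_iff by (auto intro: section_aut_id)
qed

lemma aut_carrier_mult:
  assumes "\<alpha> \<in> aut_carrier M j U" "\<beta> \<in> aut_carrier M j U"
  shows "(\<lambda>V\<in>opens_in M U. compose (ext_sections M V) (\<alpha> V) (\<beta> V)) \<in> aut_carrier M j U"
proof -
  have "intertwines (\<lambda>s. restrict s V') (ext_sections M V) (ext_sections M V')
      (compose (ext_sections M V) (\<alpha> V) (\<beta> V)) (compose (ext_sections M V') (\<alpha> V') (\<beta> V'))"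
    if "V \<in> opens_in M U" "V' \<in> opens_in M V" for V V'
    by (rule intertwines_compose[OF aut_carrier_intertwines_restrict[OF assms(1) that]
          aut_carrier_intertwines_restrict[OF assms(2) that]]) (simp add: compose_eq)
  then show ?thesis
    using section_aut_compose[OF aut_carrier_section_aut[OF assms(1)] aut_carrier_section_aut[OF assms(2)]]
    unfolding aut_carrier_iff by auto
qed

lemma aut_carrier_inv:
  assumes M: "is_model M" and \<alpha>: "\<alpha> \<in> aut_carrier M j U"
  shows "(\<lambda>V\<in>opens_in M U. \<lambda>s\<in>ext_sections M V. inv_into (ext_sections M V) (\<alpha> V) s) \<in> aut_carrier M j U"
proof -
  have s: "section_aut M j V (\<alpha> V)" if "V \<in> opens_in M U" for V
    using \<alpha> that by (rule aut_carrier_section_aut)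
  have "intertwines (\<lambda>s. restrict s V') (ext_sections M V) (ext_sections M V')
      (\<lambda>s\<in>ext_sections M V. inv_into (ext_sections M V) (\<alpha> V) s)
      (\<lambda>s\<in>ext_sections M V'. inv_into (ext_sections M V') (\<alpha> V') s)"
    if V: "V \<in> opens_in M U" and V': "V' \<in> opens_in M V" for V V'
  proof (rule intertwines_inv)
    show "intertwines (\<lambda>s. restrict s V') (ext_sections M V) (ext_sections M V') (\<alpha> V) (\<alpha> V')"
      using \<alpha> V V' by (rule aut_carrier_intertwines_restrict)
    have B: "\<alpha> V \<in> Bij (ext_sections M V)"
      using section_aut_Bij[OF s[OF V]] .
    show "bij_betw (\<lambda>s\<in>ext_sections M V. inv_into (ext_sections M V) (\<alpha> V) s)
        (ext_sections M V) (ext_sections M V)"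
      using restrict_inv_into_Bij[OF B] by (simp add: Bij_def)
    show "\<alpha> V ((\<lambda>s\<in>ext_sections M V. inv_into (ext_sections M V) (\<alpha> V) s) x) = x"
      if "x \<in> ext_sections M V" for x
      using B that by (auto simp: Bij_def bij_betw_def f_inv_into_f)
  qed
  then show ?thesis
    using section_aut_inv[OF M _ s] unfolding aut_carrier_iff by auto
qed

text \<open>The element \<open>\<alpha>\<close> puts the unit into the carrier by
  \<open>aut_carrier_one\<close>. The group laws hold on each open subset of \<open>U\<close> as
  laws of extensional bijections, and agreement there is equality since the families are extensional
  too.\<close>

lemma group_aut_sheaf:
  assumes M: "is_model M" and \<alpha>: "\<alpha> \<in> aut_carrier M j U"
  shows "group (aut_sheaf M j U)"
proof -
  have B: "\<beta> V \<in> Bij (ext_sections M V)" if "\<beta> \<in> aut_carrier M j U" "V \<in> opens_in M U" for \<beta> V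
    using section_aut_Bij[OF aut_carrier_section_aut[OF that]] .
  have ext: "\<beta> V \<in> extensional (ext_sections M V)" "\<beta> V \<in> ext_sections M V \<rightarrow> ext_sections M V"
    if "\<beta> \<in> aut_carrier M j U" "V \<in> opens_in M U" for \<beta> V
    using B[OF that] by (auto simp: Bij_def bij_betw_def)
  have eqI: "\<beta> = \<gamma>" if "\<beta> \<in> extensional (opens_in M U)" "\<gamma> \<in> extensional (opens_in M U)"
    "\<And>V. V \<in> opens_in M U \<Longrightarrow> \<beta> V = \<gamma> V" for \<beta> \<gamma> :: "('a, 'b) ext_aut"
    using that by (rule extensionalityI)
  show ?thesis
  proof (rule groupI)
    fix \<beta> \<gamma> \<delta> assume *: "\<beta> \<in> carrier (aut_sheaf M j U)" "\<gamma> \<in> carrier (aut_sheaf M j U)"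
      "\<delta> \<in> carrier (aut_sheaf M j U)"
    show "\<beta> \<otimes>\<^bsub>aut_sheaf M j U\<^esub> \<gamma> \<otimes>\<^bsub>aut_sheaf M j U\<^esub> \<delta> =
        \<beta> \<otimes>\<^bsub>aut_sheaf M j U\<^esub> (\<gamma> \<otimes>\<^bsub>aut_sheaf M j U\<^esub> \<delta>)"
      using * ext by (intro eqI) (auto simp: aut_sheaf_def compose_assoc[symmetric])
  next
    fix \<beta> assume \<beta>: "\<beta> \<in> carrier (aut_sheaf M j U)"
    show "\<one>\<^bsub>aut_sheaf M j U\<^esub> \<otimes>\<^bsub>aut_sheaf M j U\<^esub> \<beta> = \<beta>"
      using \<beta> ext by (intro eqI) (auto simp: aut_sheaf_def Id_compose aut_carrier_iff)
    let ?\<gamma> = "\<lambda>V\<in>opens_in M U. \<lambda>s\<in>ext_sections M V. inv_into (ext_sections M V) (\<beta> V) s"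
    have "?\<gamma> \<otimes>\<^bsub>aut_sheaf M j U\<^esub> \<beta> = \<one>\<^bsub>aut_sheaf M j U\<^esub>"
      using \<beta> B by (intro eqI) (auto simp: aut_sheaf_def Bij_def compose_inv_into_id)
    then show "\<exists>\<gamma>\<in>carrier (aut_sheaf M j U). \<gamma> \<otimes>\<^bsub>aut_sheaf M j U\<^esub> \<beta> = \<one>\<^bsub>aut_sheaf M j U\<^esub>"
      using aut_carrier_inv[OF M, of \<beta> j U] \<beta> by (intro bexI[of _ ?\<gamma>]) (simp_all add: aut_sheaf_def)
  qed (use aut_carrier_one[OF \<alpha>] aut_carrier_mult in \<open>simp_all add: aut_sheaf_def\<close>)
qed

lemma aut_restrict_carrier:
  assumes "\<alpha> \<in> aut_carrier M j U" "V \<subseteq> U"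
  shows "aut_restrict M V \<alpha> \<in> aut_carrier M j V"
proof -
  have "W \<in> opens_in M U" if "W \<in> opens_in M V" for W
    using that assms(2) by auto
  then show ?thesis
    using assms(1) unfolding aut_carrier_iff aut_restrict_def by auto
qed

text \<open>An automorphism over \<open>U\<close> is a family over all open subsets of
  \<open>U\<close>. Restricting it discards members of the family, so multiplicativity and
  transitivity of restriction hold literally.\<close>

lemma group_presheaf_aut:
  fixes M :: "('a, 'e) model"
  assumes "is_model M"
  shows "group_presheaf (mtop M) (aut_sheaf M j) (aut_restrict M)"
proof (rule group_presheaf.intro)
  fix U \<alpha> assume "\<alpha> \<in> carrier (aut_sheaf M j U)"
  then show "group (aut_sheaf M j U)"
    using group_aut_sheaf[OF assms] by (simp add: aut_sheaf_def)
next
  fix U V :: "'a set" assume V: "V \<subseteq> U"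
  have "W \<in> opens_in M U" if "W \<in> opens_in M V" for W
    using that V by auto
  then show "aut_restrict M V \<in> hom (aut_sheaf M j U) (aut_sheaf M j V)"
    using aut_restrict_carrier[OF _ V]
    by (auto simp: hom_def aut_sheaf_def aut_restrict_def fun_eq_iff)
next
  fix U V :: "'a set" and \<alpha> :: "('a, 'e) ext_aut" assume "V \<subseteq> U"
  then show "aut_restrict M V (aut_restrict M U \<alpha>) = aut_restrict M V \<alpha>"
    by (auto simp: aut_restrict_def fun_eq_iff)
qed

section \<open>Comparison of levels and the contradiction\<close>

lemma aut_carrier_mono:
  assumes "k \<le> j"
  shows "aut_carrier M j U \<subseteq> aut_carrier M k U"
  using assms unfolding aut_carrier_def by (blast intro: less_le_trans)

text \<open>By definition the left side is the union of the level \<open>k\<close> classes of all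
  cocycles in the level \<open>j\<close> class. These are cohomologous to \<open>Z\<close> already
  at level \<open>k\<close>, so transitivity puts the union inside one class, and reflexivity of
  \<open>Z\<close> at level \<open>j\<close> gives the converse.\<close>

lemma level_map_aut_class:
  assumes M: "is_model M" and kj: "k \<le> j" and Z: "Z \<in> aut_cocycles M j"
  shows "level_map M k (aut_class M j Z) = aut_class M k Z"
proof -
  interpret J: group_presheaf "mtop M" "aut_sheaf M j" "aut_restrict M"
    using M by (rule group_presheaf_aut)
  interpret K: group_presheaf "mtop M" "aut_sheaf M k" "aut_restrict M"
    using M by (rule group_presheaf_aut)
  have "cohomologous (mtop M) (aut_sheaf M j) (aut_restrict M)
      \<subseteq> cohomologous (mtop M) (aut_sheaf M k) (aut_restrict M)"
    using aut_carrier_mono[OF kj] by (intro cohomologous_mono) (auto simp: aut_sheaf_def)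
  then show ?thesis
    using J.cohomologous_refl[OF Z] K.cohomologous_trans
    unfolding level_map_def cech_map_def cech_class_def by blast
qed

theorem proposition1p2p9:
  fixes F :: "('b, 'x, 'e, 'y, 'f) super_family" and b\<^sub>0 :: 'b and j' :: enat
  assumes "splitting_type_deformation F b\<^sub>0"
    and "total_type F = j'"
    and "weakly_non_split (total_model F) j' (total_space F)"
  shows "\<not> classifying_map_pointed F b\<^sub>0"
proof
  assume pointed: "classifying_map_pointed F b\<^sub>0"
  let ?X = "fibre_model F" and ?Y = "total_model F" and ?i = "incl F b\<^sub>0" and ?\<rho> = "surj_map F b\<^sub>0"
  let ?Z = "total_space F" and ?k = "embed_type F b\<^sub>0"
  have b: "b\<^sub>0 \<in> points (base F)" and fam: "family F"
    using assms(1) by (auto simp: splitting_type_deformation_def)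
  then have emb: "super_embedding ?X ?Y ?i ?\<rho> (fibre F b\<^sub>0) ?Z ?k (fibre_type F b\<^sub>0) j' (embed_class F b\<^sub>0)"
    using assms(2) unfolding family_def by blast
  then have k: "2 \<le> ?k" "?k \<le> j'" and M: "is_model ?Y" and Z: "?Z \<in> aut_cocycles ?Y j'"
    and u: "u_map ?Y ?k (embed_class F b\<^sub>0) = level_map ?Y ?k (aut_class ?Y j' ?Z)"
    by (auto simp: super_embedding_def supermanifold_def)
  interpret group_presheaf "mtop ?Y" "aut_sheaf ?Y ?k" "aut_restrict ?Y"
    using M by (rule group_presheaf_aut)
  let ?R = "cohomologous (mtop ?Y) (aut_sheaf ?Y ?k) (aut_restrict ?Y)"
  let ?t = "(points ?Y, \<lambda>_. points ?Y, \<lambda>_ _. \<one>\<^bsub>aut_sheaf ?Y ?k (points ?Y)\<^esub>)"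
  have base: "aut_base ?Y ?k = ?R `` {?t}"
    by (simp add: cech_base_def cech_class_def)
  have "embed_class F b\<^sub>0 = rel_base ?X ?Y ?i ?\<rho> ?k"
    using pointed b by (simp add: classifying_map_pointed_def classifying_map_def)
  \<comment> \<open>Both sheaves have the same unit, so the two base-points are classes of the same
    cochain \<open>?t\<close>, formed with the smaller and the larger relation.\<close>
  also have "\<dots> \<subseteq> ?R `` {?t}"
  proof -
    have "cohomologous (mtop ?Y) (rel_aut_sheaf ?X ?Y ?i ?\<rho> ?k) (aut_restrict ?Y) \<subseteq> ?R"
      by (rule cohomologous_mono) (auto simp: rel_aut_sheaf_def aut_sheaf_def)
    moreover have "\<one>\<^bsub>rel_aut_sheaf ?X ?Y ?i ?\<rho> ?k U\<^esub> = \<one>\<^bsub>aut_sheaf ?Y ?k U\<^esub>" for U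
      by (simp add: rel_aut_sheaf_def)
    ultimately show ?thesis
      unfolding cech_base_def cech_class_def by auto
  qed
  finally have c: "embed_class F b\<^sub>0 \<subseteq> ?R `` {?t}" .
  have lvl: "level_map ?Y ?k (aut_class ?Y j' ?Z) = ?R `` {?Z}"
    using level_map_aut_class[OF M k(2) Z] by (simp add: cech_class_def)
  have "?Z \<in> aut_cocycles ?Y ?k"
    using aut_carrier_mono[OF k(2)]
    by (intro subsetD[OF cocycles_mono Z]) (simp_all add: aut_sheaf_def)
  \<comment> \<open>Membership of \<open>?Z\<close> yields a cocycle in the class of the embedding
    that is cohomologous to \<open>?Z\<close>, and by \<open>c\<close> also to \<open>?t\<close>. As
    \<open>cohomologous\<close> relates cocycles only, the resulting pair \<open>(?t, ?Z)\<close>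
    also certifies that \<open>?t\<close> is a cocycle.\<close>
  then have "?Z \<in> u_map ?Y ?k (embed_class F b\<^sub>0)"
    using cohomologous_refl u lvl by blast
  then have "(?t, ?Z) \<in> ?R"
    using c cohomologous_trans unfolding u_map_def cech_map_def by blast
  then have "?R `` {?Z} = ?R `` {?t}"
    using cohomologous_sym cohomologous_trans by blast
  then have "level_map ?Y ?k (aut_class ?Y j' ?Z) = aut_base ?Y ?k"
    using lvl base by simp
  \<comment> \<open>At the top level the level map fixes the class, so the first condition of weak
    non-splitness takes the form of the second with \<open>k = j'\<close>.\<close>
  moreover have "level_map ?Y j' (aut_class ?Y j' ?Z) = aut_class ?Y j' ?Z"
    using level_map_aut_class[OF M order_refl Z] .
  ultimately show False
    using assms(3) k unfolding weakly_non_split_def by (metis order_le_less)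
qed

end
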